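(* Let $v_0>0$ and let $v_t=v_0\exp(B_t^F)$, where $B_t^F=\int_0^tF(t,s)\,dB_s$. Then for $t>0$ the variance process $v_t$ has mean $$\mathbb{E}(v_t)=v_0\exp\left\{\frac12\int_0^tF^2(t,s)\,ds\right\}$$ and has Malliavin derivative, for $0\le s\le t$, $$D_sv_t=v_tF(t,s).$$ Furthermore, $$D_s\left(\frac1{v_t}\right)=-\frac1{v_t}F(t,s).$$
   Context: $(\Omega,\mathcal{F},\mathbb{P})$ is a complete probability space carrying a standard real Brownian motion $(B_t)_{t\ge0}$. The kernel $F:\mathbb{R}\times\mathbb{R}\to\mathbb{R}$ is assumed throughout to be continuous, with $F\in L^2(\mathbb{R}^2)$, $\int_0^{t\wedge s}F(t,r)F(s,r)\,dr\ne0$ for all $t,s>0$, and $F(t,\cdot)\in L^2(\mathbb{R})$ for all $t\ge0$. $D_s$ denotes the Malliavin derivative with respect to the Brownian motion $B$: for a functional $V$ of $B$ and $h$ in the Cameron–Martin space (absolutely continuous, $h(0)=0$, $h'\in L^2$), the directional derivative $D_hV=\frac{d}{d\varepsilon}\big|_{\varepsilon=0}V(B+\varepsilon h)$ satisfies $D_hV=\int_0^tD_sV\,\dot h(s)\,ds$ (for $V$ depending on $B$ up to time $t$). *)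

theory Defs
  imports "HOL-Probability.Probability"
begin

definition square_integrable :: "'a measure \<Rightarrow> ('a \<Rightarrow> real) \<Rightarrow> bool" where
  "square_integrable M f \<longleftrightarrow> f \<in> borel_measurable M \<and> integrable M (\<lambda>x. (f x)\<^sup>2)"

text \<open>Only the values \<open>B t\<close> for \<open>t \<ge> 0\<close> are relevant.\<close>

definition standard_brownian_motion :: "'a measure \<Rightarrow> (real \<Rightarrow> 'a \<Rightarrow> real) \<Rightarrow> bool" where
  "standard_brownian_motion M B \<longleftrightarrow>
     prob_space M \<and>
     (\<forall>t\<ge>0. B t \<in> borel_measurable M) \<and>
     (AE \<omega> in M. B 0 \<omega> = 0) \<and>
     (\<forall>(n::nat) (\<tau>::nat \<Rightarrow> real). 0 \<le> \<tau> 0 \<and> (\<forall>i<n. \<tau> i \<le> \<tau> (Suc i)) \<longrightarrow>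
        prob_space.indep_vars M (\<lambda>_. borel) (\<lambda>i \<omega>. B (\<tau> (Suc i)) \<omega> - B (\<tau> i) \<omega>) {..<n}) \<and>
     (\<forall>s t. 0 \<le> s \<and> s < t \<longrightarrow>
        distributed M lborel (\<lambda>\<omega>. B t \<omega> - B s \<omega>) (normal_density 0 (sqrt (t - s)))) \<and>
     (AE \<omega> in M. continuous_on {0..} (\<lambda>t. B t \<omega>))"

text \<open>
  A triple \<open>(n, \<tau>, c)\<close> encodes the step function taking the value \<open>c i\<close> on the interval
  \<open>(\<tau> i, \<tau> (i + 1)]\<close> for \<open>i < n\<close>, and \<open>0\<close> elsewhere.
\<close>

type_synonym step = "nat \<times> (nat \<Rightarrow> real) \<times> (nat \<Rightarrow> real)"

definition step_on :: "real \<Rightarrow> step \<Rightarrow> bool" where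
  "step_on t = (\<lambda>(n, \<tau>, c). 0 \<le> \<tau> 0 \<and> (\<forall>i<n. \<tau> i \<le> \<tau> (Suc i)) \<and> \<tau> n \<le> t)"

definition step_fun :: "step \<Rightarrow> real \<Rightarrow> real" where
  "step_fun = (\<lambda>(n, \<tau>, c) s. \<Sum>i<n. c i * indicator {\<tau> i<..\<tau> (Suc i)} s)"

definition step_integral :: "(real \<Rightarrow> 'a \<Rightarrow> real) \<Rightarrow> step \<Rightarrow> 'a \<Rightarrow> real" where
  "step_integral B = (\<lambda>(n, \<tau>, c) \<omega>. \<Sum>i<n. c i * (B (\<tau> (Suc i)) \<omega> - B (\<tau> i) \<omega>))"

text \<open>
  \<open>X\<close> is a version of the Wiener integral of \<open>f\<close> over \<open>[0, t]\<close>: an \<open>L\<^sup>2\<close> limit of the integrals of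
  step functions that converge to \<open>f\<close> in \<open>L\<^sup>2([0, t])\<close>. By the Ito isometry \<open>X\<close> exists and is
  determined up to almost sure equality; it does not depend on the approximating sequence.
\<close>

definition has_wiener_integral ::
  "'a measure \<Rightarrow> (real \<Rightarrow> 'a \<Rightarrow> real) \<Rightarrow> real \<Rightarrow> (real \<Rightarrow> real) \<Rightarrow> ('a \<Rightarrow> real) \<Rightarrow> bool" where
  "has_wiener_integral M B t f X \<longleftrightarrow>
     square_integrable (restrict_space lborel {0..t}) f \<and>
     square_integrable M X \<and>
     (\<exists>\<phi> :: nat \<Rightarrow> step.
        (\<forall>k. step_on t (\<phi> k)) \<and>
        (\<lambda>k. \<integral>\<^sup>+ s. ennreal ((step_fun (\<phi> k) s - f s)\<^sup>2) \<partial>restrict_space lborel {0..t}) \<longlonglongrightarrow> 0 \<and>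
        (\<lambda>k. \<integral>\<^sup>+ \<omega>. ennreal ((step_integral B (\<phi> k) \<omega> - X \<omega>)\<^sup>2) \<partial>M) \<longlonglongrightarrow> 0)"

definition wiener_integral ::
  "'a measure \<Rightarrow> (real \<Rightarrow> 'a \<Rightarrow> real) \<Rightarrow> real \<Rightarrow> (real \<Rightarrow> real) \<Rightarrow> 'a \<Rightarrow> real" where
  "wiener_integral M B t f = (SOME X. has_wiener_integral M B t f X)"

definition abs_continuous_on :: "real set \<Rightarrow> (real \<Rightarrow> real) \<Rightarrow> bool" where
  "abs_continuous_on S h \<longleftrightarrow>
     (\<forall>\<epsilon>>0. \<exists>\<delta>>0. \<forall>(n::nat) (a::nat \<Rightarrow> real) (b::nat \<Rightarrow> real).
        (\<forall>i<n. a i \<le> b i \<and> {a i..b i} \<subseteq> S) \<and>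
        disjoint_family_on (\<lambda>i. {a i<..<b i}) {..<n} \<and>
        (\<Sum>i<n. b i - a i) < \<delta> \<longrightarrow>
        (\<Sum>i<n. \<bar>h (b i) - h (a i)\<bar>) < \<epsilon>)"

text \<open>
  \<open>h\<close> belongs to the Cameron--Martin space and \<open>h'\<close> is (a Borel version of) its derivative. An
  absolutely continuous function is differentiable almost everywhere, so the existence of \<open>h'\<close>
  as an almost everywhere derivative is not a restriction on \<open>h\<close>; only its square integrability is.
\<close>

definition cameron_martin :: "(real \<Rightarrow> real) \<Rightarrow> (real \<Rightarrow> real) \<Rightarrow> bool" where
  "cameron_martin h h' \<longleftrightarrow>
     h 0 = 0 \<and>
     (\<forall>T>0. abs_continuous_on {0..T} h) \<and>
     (AE s in lborel. 0 < s \<longrightarrow> (h has_real_derivative h' s) (at s)) \<and>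
     square_integrable (restrict_space lborel {0..}) h'"

definition path :: "(real \<Rightarrow> 'a \<Rightarrow> real) \<Rightarrow> real \<Rightarrow> 'a \<Rightarrow> real \<Rightarrow> real" where
  "path B t \<omega> = (\<lambda>u\<in>{0..t}. B u \<omega>)"

text \<open>
  \<open>V\<close> is a square integrable functional of the path of \<open>B\<close> on \<open>[0, t]\<close>, and the process \<open>D\<close> is its
  Malliavin derivative: \<open>V = \<Phi>(B)\<close> almost surely for a measurable \<open>\<Phi>\<close> on path space, and for
  every \<open>h\<close> in the Cameron--Martin space
  \<open>d/d\<epsilon> \<Phi>(B + \<epsilon>h) = \<integral>\<^sub>0\<^sup>t D\<^sub>s h'(s) ds\<close> at \<open>\<epsilon> = 0\<close>.
  The laws of \<open>B\<close> and of \<open>B + \<epsilon>h\<close> are equivalent (Cameron--Martin), so for fixed \<open>\<epsilon>\<close> the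
  variable \<open>\<Phi>(B + \<epsilon>h)\<close> depends on \<open>V\<close> only, up to null sets. Taking \<open>\<epsilon> = 1/k\<close> shows that the
  derivative is the same, almost surely, for all \<open>\<Phi>\<close> for which it exists; therefore
  \<open>D\<close> is determined by \<open>V\<close> up to null sets of \<open>[0, t] \<times> \<Omega>\<close>. The representative \<open>\<Phi>\<close> has
  to be chosen, because changing it on a null set of paths can destroy differentiability in \<open>\<epsilon>\<close>.
\<close>

definition has_malliavin_derivative ::
  "'a measure \<Rightarrow> (real \<Rightarrow> 'a \<Rightarrow> real) \<Rightarrow> real \<Rightarrow> ('a \<Rightarrow> real) \<Rightarrow> (real \<Rightarrow> 'a \<Rightarrow> real) \<Rightarrow> bool" where
  "has_malliavin_derivative M B t V D \<longleftrightarrow>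
     square_integrable M V \<and>
     square_integrable (restrict_space lborel {0..t} \<Otimes>\<^sub>M M) (\<lambda>(s, \<omega>). D s \<omega>) \<and>
     (\<exists>\<Phi> :: (real \<Rightarrow> real) \<Rightarrow> real.
        \<Phi> \<in> borel_measurable (PiM {0..t} (\<lambda>_. borel)) \<and>
        (AE \<omega> in M. V \<omega> = \<Phi> (path B t \<omega>)) \<and>
        (\<forall>h h'. cameron_martin h h' \<longrightarrow>
           (AE \<omega> in M.
              ((\<lambda>\<epsilon>. \<Phi> (path (\<lambda>u \<omega>. B u \<omega> + \<epsilon> * h u) t \<omega>)) has_real_derivative
                 (LINT s:{0..t}|lborel. D s \<omega> * h' s)) (at 0))))"

end

theory Submission
  imports Defs
begin

text \<open>
  The process enters only through the Wiener integral \<open>X = \<integral>\<^sub>0\<^sup>t F(t, s) dB\<^sub>s\<close>: almost surely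
  \<open>v\<^sub>t = v\<^sub>0 exp(X)\<close> and \<open>1 / v\<^sub>t = (1 / v\<^sub>0) exp(-X)\<close>. Everything is therefore proved for
  \<open>V = c exp(a X)\<close>, where \<open>X\<close> is the Wiener integral over \<open>[0, t]\<close> of a function \<open>f\<close>, and used with
  \<open>a = 1\<close> and \<open>a = -1\<close>. Let \<open>\<phi>\<^sub>k\<close> be step functions that converge to \<open>f\<close> in \<open>L\<^sup>2([0, t])\<close>, and let \<open>I\<^sub>k\<close> be
  their integrals, finite linear combinations of Brownian increments that converge to \<open>X\<close> in \<open>L\<^sup>2\<close>.

  \<^emph>\<open>Exponential moments\<close> (\<open>exp_wiener_integral\<close>). The increments in \<open>I\<^sub>k\<close> are independent and
  Gaussian, so \<open>E exp(a I\<^sub>k) = exp(a\<^sup>2/2 \<integral> \<phi>\<^sub>k\<^sup>2)\<close>. Fatou's lemma bounds \<open>E exp(2 a X)\<close>; with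
  \<open>|e\<^sup>x - e\<^sup>y| \<le> |x - y| (e\<^sup>x + e\<^sup>y)\<close> and the Cauchy--Schwarz inequality, the convergence of \<open>I\<^sub>k\<close> in \<open>L\<^sup>2\<close>
  then gives the convergence of \<open>exp(a I\<^sub>k)\<close> in \<open>L\<^sup>1\<close>, hence \<open>E exp(a X) = exp(a\<^sup>2/2 \<integral> f\<^sup>2)\<close>.

  \<^emph>\<open>Malliavin derivative\<close> (\<open>has_malliavin_derivative_exp_wiener_integral\<close>). After passing to a
  subsequence, \<open>I\<^sub>k \<rightarrow> X\<close> almost surely. As \<open>I\<^sub>k\<close> is a function of the path, \<open>V = \<Phi>(B)\<close> almost surely
  for \<open>\<Phi>(x) = c exp(a lim\<^sub>k I\<^sub>k(x))\<close>. The functional \<open>I\<^sub>k\<close> is linear, and for \<open>h\<close> in the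
  Cameron--Martin space \<open>I\<^sub>k(h) = \<integral> \<phi>\<^sub>k h' \<rightarrow> \<integral> f h'\<close>. So at each \<open>\<omega>\<close> where \<open>I\<^sub>k(B)\<close> converges,
  \<open>I\<^sub>k(B + \<epsilon>h)\<close> converges for all \<open>\<epsilon>\<close> simultaneously, and
  \<open>\<Phi>(B + \<epsilon>h) = \<Phi>(B) exp(a \<epsilon> \<integral> f h')\<close>, whose derivative at \<open>\<epsilon> = 0\<close> is \<open>\<integral> a V f h'\<close>.
  The formula for \<open>I\<^sub>k(h)\<close> rests on the fundamental theorem of calculus for absolutely
  continuous functions (\<open>has_integral_derivative_abs_continuous_on\<close>).

  \<^emph>\<open>Existence\<close> (\<open>ex_has_wiener_integral\<close>). The Wiener integral is a choice among its versions,
  so a version has to be constructed before anything is known about the chosen one. For continuous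
  \<open>f\<close> this is done with uniform step approximations and the Ito isometry.
\<close>

section \<open>Square integrable functions\<close>

lemma LIMSEQ_zero_of_le:
  fixes f g :: "nat \<Rightarrow> real"
  assumes "\<And>k. 0 \<le> f k" "\<And>k. f k \<le> g k" "g \<longlonglongrightarrow> 0"
  shows "f \<longlonglongrightarrow> 0"
  by (rule tendsto_sandwich[OF always_eventually always_eventually tendsto_const assms(3)])
    (use assms in auto)

text \<open>
  The preimages under \<open>f\<close> and \<open>g\<close> differ by subsets of a null set, which completeness makes measurable.
\<close>

lemma (in complete_measure) borel_measurable_AE_eq:
  fixes f g :: "'a \<Rightarrow> real"
  assumes f: "f \<in> borel_measurable M" and eq: "AE x in M. f x = g x"
  shows "g \<in> borel_measurable M"
proof (rule measurableI)
  fix A :: "real set" assume "A \<in> sets borel"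
  define Z where "Z = {x \<in> space M. f x \<noteq> g x}"
  have Z: "Z \<in> null_sets M" using eq by (simp add: AE_iff_null_sets Z_def)
  have "g -` A \<inter> space M = (f -` A \<inter> space M - Z) \<union> (g -` A \<inter> Z)"
    by (auto simp: Z_def)
  moreover have "g -` A \<inter> Z \<in> null_sets M" by (rule complete2[OF _ Z]) auto
  moreover have "f -` A \<inter> space M \<in> sets M" using f \<open>A \<in> sets borel\<close> by measurable
  ultimately show "g -` A \<inter> space M \<in> sets M" using Z by (auto intro: null_setsD2)
qed simp

lemma square_integrable_mult:
  assumes "square_integrable M f" "square_integrable M g"
  shows "integrable M (\<lambda>x. f x * g x)"
proof (rule Bochner_Integration.integrable_bound)
  show "integrable M (\<lambda>x. (f x)\<^sup>2 + (g x)\<^sup>2)"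
    using assms by (auto simp: square_integrable_def)
  show "(\<lambda>x. f x * g x) \<in> borel_measurable M"
    using assms by (auto simp: square_integrable_def)
  have "\<bar>a * b\<bar> \<le> \<bar>a\<^sup>2 + b\<^sup>2\<bar>" for a b :: real
  proof -
    have "0 \<le> (\<bar>a\<bar> - \<bar>b\<bar>)\<^sup>2" by simp
    then have "2 * \<bar>a * b\<bar> \<le> a\<^sup>2 + b\<^sup>2" by (simp add: power2_diff abs_mult)
    then show ?thesis by simp
  qed
  then show "AE x in M. norm (f x * g x) \<le> norm ((f x)\<^sup>2 + (g x)\<^sup>2)"
    by simp
qed

lemma square_integrable_add:
  assumes "square_integrable M f" "square_integrable M g"
  shows "square_integrable M (\<lambda>x. f x + g x)"
  using assms square_integrable_mult[OF assms]
  by (auto simp: square_integrable_def power2_sum mult.assoc)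

lemma square_integrable_cmult:
  "square_integrable M f \<Longrightarrow> square_integrable M (\<lambda>x. c * f x)"
  by (auto simp: square_integrable_def power_mult_distrib)

lemma square_integrable_diff:
  assumes "square_integrable M f" "square_integrable M g"
  shows "square_integrable M (\<lambda>x. f x - g x)"
  using square_integrable_add[OF assms(1) square_integrable_cmult[OF assms(2), of "-1"]] by simp

lemma square_integrable_abs:
  "square_integrable M f \<Longrightarrow> square_integrable M (\<lambda>x. \<bar>f x\<bar>)"
  by (auto simp: square_integrable_def)

lemma square_integrable_sum:
  assumes "\<And>i. i \<in> I \<Longrightarrow> square_integrable M (f i)"
  shows "square_integrable M (\<lambda>x. \<Sum>i\<in>I. f i x)"
  using assms
proof (induction I rule: infinite_finite_induct)
  case (insert i I)
  then show ?case
    using square_integrable_add[of M "f i" "\<lambda>x. \<Sum>i\<in>I. f i x"] by auto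
qed (simp_all add: square_integrable_def)

lemma square_integrable_cong_AE:
  assumes "square_integrable M f" "g \<in> borel_measurable M" "AE x in M. f x = g x"
  shows "square_integrable M g"
proof -
  have "integrable M (\<lambda>x. (g x)\<^sup>2) \<longleftrightarrow> integrable M (\<lambda>x. (f x)\<^sup>2)"
    by (rule integrable_cong_AE) (use assms in \<open>auto simp: square_integrable_def\<close>)
  then show ?thesis
    using assms by (simp add: square_integrable_def)
qed

lemma Cauchy_Schwarz_integral:
  assumes f: "square_integrable M f" and g: "square_integrable M g"
  shows "(\<integral>x. f x * g x \<partial>M)\<^sup>2 \<le> (\<integral>x. (f x)\<^sup>2 \<partial>M) * (\<integral>x. (g x)\<^sup>2 \<partial>M)"
proof -
  define A B C where "A = (\<integral>x. (f x)\<^sup>2 \<partial>M)" and "B = (\<integral>x. (g x)\<^sup>2 \<partial>M)"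
    and "C = (\<integral>x. f x * g x \<partial>M)"
  have i: "integrable M (\<lambda>x. (f x)\<^sup>2)" "integrable M (\<lambda>x. (g x)\<^sup>2)"
    using f g by (auto simp: square_integrable_def)
  have fg: "integrable M (\<lambda>x. f x * g x)"
    by (rule square_integrable_mult[OF f g])
  \<comment> \<open>\<open>B f - C g\<close> is \<open>B\<close> times the part of \<open>f\<close> orthogonal to \<open>g\<close>.\<close>
  have pos: "0 \<le> B * (B * A - C\<^sup>2)"
  proof -
    have "0 \<le> (\<integral>x. (B * f x - C * g x)\<^sup>2 \<partial>M)" by simp
    also have "\<dots> = (\<integral>x. B\<^sup>2 * (f x)\<^sup>2 - 2 * B * C * (f x * g x) + C\<^sup>2 * (g x)\<^sup>2 \<partial>M)"
      by (intro Bochner_Integration.integral_cong)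
         (auto simp: power2_eq_square algebra_simps)
    also have "\<dots> = B\<^sup>2 * A - 2 * B * C * C + C\<^sup>2 * B"
      using i fg by (simp add: A_def B_def C_def)
    finally show ?thesis by (simp add: power2_eq_square algebra_simps)
  qed
  have "C\<^sup>2 \<le> A * B"
  proof (cases "B = 0")
    case True
    then have "AE x in M. (g x)\<^sup>2 = 0"
      using integral_nonneg_eq_0_iff_AE[OF i(2)] by (simp add: B_def)
    then have "AE x in M. f x * g x = 0" by eventually_elim simp
    then have "C = 0" unfolding C_def by (rule integral_eq_zero_AE)
    then show ?thesis using True by simp
  next
    case False
    moreover have "0 \<le> B" by (simp add: B_def)
    ultimately have "0 < B" by simp
    then have "0 \<le> B * A - C\<^sup>2" using pos by (simp add: zero_le_mult_iff)
    then show ?thesis by (simp add: mult.commute)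
  qed
  then show ?thesis by (simp add: A_def B_def C_def)
qed

text \<open>
  The factors \<open>g\<^sub>k\<close> may vary as long as they stay bounded in \<open>L\<^sup>2\<close>. For the convergence of
  exponentials they are the factors \<open>e\<^sup>x + e\<^sup>y\<close> of a mean value inequality.
\<close>

lemma tendsto_integral_mult_L2:
  fixes f :: "nat \<Rightarrow> 'a \<Rightarrow> real"
  assumes f: "\<And>k. square_integrable M (f k)" and F: "square_integrable M F"
    and lim: "(\<lambda>k. \<integral>x. (f k x - F x)\<^sup>2 \<partial>M) \<longlonglongrightarrow> 0"
    and g: "\<And>k. square_integrable M (g k)" and bd: "\<And>k. (\<integral>x. (g k x)\<^sup>2 \<partial>M) \<le> C"
  shows "(\<lambda>k. \<integral>x. \<bar>f k x - F x\<bar> * g k x \<partial>M) \<longlonglongrightarrow> 0"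
proof -
  have "(\<lambda>k. (\<integral>x. (f k x - F x)\<^sup>2 \<partial>M) * C) \<longlonglongrightarrow> 0 * C"
    by (intro tendsto_intros lim)
  then have lim': "(\<lambda>k. (\<integral>x. (f k x - F x)\<^sup>2 \<partial>M) * C) \<longlonglongrightarrow> 0" by simp
  have le: "(\<integral>x. \<bar>f k x - F x\<bar> * g k x \<partial>M)\<^sup>2 \<le> (\<integral>x. (f k x - F x)\<^sup>2 \<partial>M) * C" for k
    using Cauchy_Schwarz_integral[OF square_integrable_abs[OF square_integrable_diff[OF f[of k] F]] g[of k]]
      mult_left_mono[OF bd[of k], of "\<integral>x. (f k x - F x)\<^sup>2 \<partial>M"] by simp
  have "(\<lambda>k. (\<integral>x. \<bar>f k x - F x\<bar> * g k x \<partial>M)\<^sup>2) \<longlonglongrightarrow> 0"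
    by (rule tendsto_sandwich[OF always_eventually always_eventually tendsto_const lim'])
      (use le in \<open>simp_all\<close>)
  then show ?thesis
    by simp
qed

lemma tendsto_integral_mult_const_L2:
  fixes f :: "nat \<Rightarrow> 'a \<Rightarrow> real"
  assumes f: "\<And>k. square_integrable M (f k)" and F: "square_integrable M F"
    and lim: "(\<lambda>k. \<integral>x. (f k x - F x)\<^sup>2 \<partial>M) \<longlonglongrightarrow> 0"
    and g: "square_integrable M g"
  shows "(\<lambda>k. \<integral>x. f k x * g x \<partial>M) \<longlonglongrightarrow> (\<integral>x. F x * g x \<partial>M)"
proof (rule LIM_zero_cancel, rule tendsto_rabs_zero_cancel)
  have "(\<lambda>k. \<integral>x. \<bar>f k x - F x\<bar> * \<bar>g x\<bar> \<partial>M) \<longlonglongrightarrow> 0"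
    by (rule tendsto_integral_mult_L2[OF f F lim square_integrable_abs[OF g] order.refl])
  then show "(\<lambda>k. \<bar>(\<integral>x. f k x * g x \<partial>M) - (\<integral>x. F x * g x \<partial>M)\<bar>) \<longlonglongrightarrow> 0"
  proof (rule tendsto_sandwich[OF _ always_eventually tendsto_const, rotated 2])
    show "\<forall>k. \<bar>(\<integral>x. f k x * g x \<partial>M) - (\<integral>x. F x * g x \<partial>M)\<bar> \<le> (\<integral>x. \<bar>f k x - F x\<bar> * \<bar>g x\<bar> \<partial>M)"
    proof
    fix k
    have "\<bar>(\<integral>x. f k x * g x \<partial>M) - (\<integral>x. F x * g x \<partial>M)\<bar> = \<bar>\<integral>x. (f k x - F x) * g x \<partial>M\<bar>"
      using square_integrable_mult[OF F g] square_integrable_mult[OF f g]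
      by (simp add: left_diff_distrib)
    also have "\<dots> \<le> (\<integral>x. \<bar>(f k x - F x) * g x\<bar> \<partial>M)"
      by (rule integral_abs_bound)
    finally show "\<bar>(\<integral>x. f k x * g x \<partial>M) - (\<integral>x. F x * g x \<partial>M)\<bar> \<le> (\<integral>x. \<bar>f k x - F x\<bar> * \<bar>g x\<bar> \<partial>M)"
      by (simp add: abs_mult)
    qed
  qed simp
qed

text \<open>
  Expand \<open>f\<^sub>k\<^sup>2 = (f\<^sub>k - F)\<^sup>2 + 2 f\<^sub>k F - F\<^sup>2\<close>; only the mixed term remains to be
  treated.
\<close>

lemma tendsto_integral_square_L2:
  fixes f :: "nat \<Rightarrow> 'a \<Rightarrow> real"
  assumes f: "\<And>k. square_integrable M (f k)" and F: "square_integrable M F"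
    and lim: "(\<lambda>k. \<integral>x. (f k x - F x)\<^sup>2 \<partial>M) \<longlonglongrightarrow> 0"
  shows "(\<lambda>k. \<integral>x. (f k x)\<^sup>2 \<partial>M) \<longlonglongrightarrow> (\<integral>x. (F x)\<^sup>2 \<partial>M)"
proof -
  have "(\<integral>x. (f k x)\<^sup>2 \<partial>M) =
      (\<integral>x. (f k x - F x)\<^sup>2 \<partial>M) + 2 * (\<integral>x. f k x * F x \<partial>M) - (\<integral>x. (F x)\<^sup>2 \<partial>M)" for k
  proof -
    have "(\<integral>x. (f k x)\<^sup>2 \<partial>M) = (\<integral>x. (f k x - F x)\<^sup>2 + 2 * (f k x * F x) - (F x)\<^sup>2 \<partial>M)"
      by (intro Bochner_Integration.integral_cong) (auto simp: power2_eq_square algebra_simps)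
    also have "\<dots> = (\<integral>x. (f k x - F x)\<^sup>2 \<partial>M) + 2 * (\<integral>x. f k x * F x \<partial>M) - (\<integral>x. (F x)\<^sup>2 \<partial>M)"
      using square_integrable_diff[OF f[of k] F] F square_integrable_mult[OF f[of k] F]
      by (subst Bochner_Integration.integral_diff) (auto simp: square_integrable_def)
    finally show ?thesis .
  qed
  moreover have "(\<lambda>k. (\<integral>x. (f k x - F x)\<^sup>2 \<partial>M) + 2 * (\<integral>x. f k x * F x \<partial>M) - (\<integral>x. (F x)\<^sup>2 \<partial>M))
      \<longlonglongrightarrow> 0 + 2 * (\<integral>x. F x * F x \<partial>M) - (\<integral>x. (F x)\<^sup>2 \<partial>M)"
    by (intro tendsto_intros lim tendsto_integral_mult_const_L2[OF f F lim F])
  ultimately show ?thesis by (simp add: power2_eq_square)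
qed

lemma tendsto_nn_integral_square_iff:
  fixes f :: "nat \<Rightarrow> 'a \<Rightarrow> real"
  assumes f: "\<And>k. square_integrable M (f k)" and F: "square_integrable M F"
  shows "(\<lambda>k. \<integral>\<^sup>+x. ennreal ((f k x - F x)\<^sup>2) \<partial>M) \<longlonglongrightarrow> 0 \<longleftrightarrow>
    (\<lambda>k. \<integral>x. (f k x - F x)\<^sup>2 \<partial>M) \<longlonglongrightarrow> 0"
proof -
  have "(\<integral>\<^sup>+x. ennreal ((f k x - F x)\<^sup>2) \<partial>M) = ennreal (\<integral>x. (f k x - F x)\<^sup>2 \<partial>M)" for k
    using square_integrable_diff[OF f[of k] F]
    by (intro nn_integral_eq_integral) (auto simp: square_integrable_def)
  then show ?thesis
    using tendsto_ennreal_iff[of _ sequentially 0] by (auto simp: ennreal_0[symmetric] simp del: ennreal_0)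
qed

lemma square_integrable_pair_mult:
  assumes "sigma_finite_measure M1" "sigma_finite_measure M2"
    and f: "square_integrable M1 f" and g: "square_integrable M2 g"
  shows "square_integrable (M1 \<Otimes>\<^sub>M M2) (\<lambda>(x, y). f x * g y)"
proof -
  interpret pair_sigma_finite M1 M2
    using assms(1,2) by (rule pair_sigma_finite.intro)
  have [measurable]: "f \<in> borel_measurable M1" "g \<in> borel_measurable M2"
    using f g by (auto simp: square_integrable_def)
  have "integrable (M1 \<Otimes>\<^sub>M M2) (\<lambda>(x, y). (f x)\<^sup>2 * (g y)\<^sup>2)"
    using f g by (intro Fubini_integrable) (auto simp: square_integrable_def abs_mult)
  then show ?thesis
    by (simp add: square_integrable_def case_prod_unfold power_mult_distrib)
qed

text \<open>
  Fatou's lemma for real integrals: the bound on the integrals also yields the integrability of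
  the limit.
\<close>

lemma integral_le_of_AE_tendsto:
  fixes f :: "nat \<Rightarrow> 'a \<Rightarrow> real"
  assumes f: "\<And>k. integrable M (f k)" "\<And>k x. 0 \<le> f k x"
    and g: "g \<in> borel_measurable M" "\<And>x. 0 \<le> g x"
    and lim: "AE x in M. (\<lambda>k. f k x) \<longlonglongrightarrow> g x"
    and bound: "eventually (\<lambda>k. (\<integral>x. f k x \<partial>M) \<le> C) sequentially"
  shows "integrable M g" "(\<integral>x. g x \<partial>M) \<le> C"
proof -
  have C: "0 \<le> C"
  proof -
    obtain k where "(\<integral>x. f k x \<partial>M) \<le> C"
      using eventually_happens'[OF _ bound] by auto
    moreover have "0 \<le> (\<integral>x. f k x \<partial>M)" using f(2) by simp
    ultimately show ?thesis by simp
  qed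
  have "(\<integral>\<^sup>+x. ennreal (g x) \<partial>M) = (\<integral>\<^sup>+x. liminf (\<lambda>k. ennreal (f k x)) \<partial>M)"
  proof (rule nn_integral_cong_AE, use lim in eventually_elim)
    case (elim x)
    then have "(\<lambda>k. ennreal (f k x)) \<longlonglongrightarrow> ennreal (g x)" by (rule tendsto_ennrealI)
    then show ?case by (simp add: lim_imp_Liminf)
  qed
  also have "\<dots> \<le> liminf (\<lambda>k. \<integral>\<^sup>+x. ennreal (f k x) \<partial>M)"
    using f(1) by (intro nn_integral_liminf) auto
  also have "\<dots> = liminf (\<lambda>k. ennreal (\<integral>x. f k x \<partial>M))"
    using f by (simp add: nn_integral_eq_integral)
  also have "\<dots> \<le> ennreal C"
    using bound by (intro Liminf_le) (auto elim!: eventually_mono intro: ennreal_leI)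
  finally have le: "(\<integral>\<^sup>+x. ennreal (g x) \<partial>M) \<le> ennreal C" .
  then show int: "integrable M g"
    using g by (intro integrableI_bounded) (auto intro: order.strict_trans1)
  show "(\<integral>x. g x \<partial>M) \<le> C"
    using le C int g by (simp add: nn_integral_eq_integral)
qed

text \<open>
  Completeness of \<open>L\<^sup>2\<close> for sequences that are Cauchy at a geometric rate. The expected
  increments are then summable, so the increments are almost surely absolutely summable and
  the pointwise limit exists; Fatou's lemma shows that it is also the limit in \<open>L\<^sup>2\<close>.
\<close>

lemma (in prob_space) geometric_L2_Cauchy_imp_convergent:
  fixes X :: "nat \<Rightarrow> 'a \<Rightarrow> real"
  assumes X: "\<And>k. square_integrable M (X k)"
    and bound: "\<And>j m. j \<le> m \<Longrightarrow> expectation (\<lambda>\<omega>. (X j \<omega> - X m \<omega>)\<^sup>2) \<le> C * (1 / 4) ^ j"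
  obtains Y where "square_integrable M Y" "(\<lambda>k. expectation (\<lambda>\<omega>. (X k \<omega> - Y \<omega>)\<^sup>2)) \<longlonglongrightarrow> 0"
proof -
  have [measurable]: "X k \<in> borel_measurable M" for k
    using X by (simp add: square_integrable_def)
  define D where "D j \<omega> = \<bar>X (Suc j) \<omega> - X j \<omega>\<bar>" for j \<omega>
  have D: "square_integrable M (D j)" for j
    unfolding D_def by (intro square_integrable_abs square_integrable_diff X)
  then have D_int: "integrable M (D j)" for j
    by (auto simp: square_integrable_def intro: square_integrable_imp_integrable)
  have C: "0 \<le> C"
    using bound[of 0 0] by simp
  have D_le: "expectation (D j) \<le> sqrt C * (1 / 2) ^ j" for j
  proof -
    have "(expectation (D j))\<^sup>2 \<le> expectation (\<lambda>\<omega>. (D j \<omega>)\<^sup>2)"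
      using Cauchy_Schwarz_integral[OF D, of "\<lambda>_. 1"] by (simp add: square_integrable_def prob_space)
    also have "\<dots> = expectation (\<lambda>\<omega>. (X j \<omega> - X (Suc j) \<omega>)\<^sup>2)"
      by (simp add: D_def power2_commute)
    also have "\<dots> \<le> C * (1 / 4) ^ j" by (rule bound) simp
    also have "\<dots> = (sqrt C * (1 / 2) ^ j)\<^sup>2"
    proof -
      have "((1 / 2) ^ j)\<^sup>2 = ((1 / 4) ^ j :: real)"
        by (simp add: power2_eq_square flip: power_mult_distrib)
      then show ?thesis using C by (simp add: power_mult_distrib)
    qed
    finally show ?thesis
      by (rule power2_le_imp_le) (use C in simp)
  qed
  have "AE \<omega> in M. (\<Sum>j. ennreal (D j \<omega>)) \<noteq> \<infinity>"
  proof (rule nn_integral_noteq_infinite)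
    have "summable (\<lambda>j. expectation (D j))"
    proof (rule summable_comparison_test')
      show "summable (\<lambda>j. sqrt C * (1 / 2) ^ j)"
        by (intro summable_mult summable_geometric) simp
      show "norm (expectation (D j)) \<le> sqrt C * (1 / 2) ^ j" for j
        using D_le[of j] by (simp add: D_def)
    qed
    then have "(\<Sum>j. ennreal (expectation (D j))) \<noteq> \<infinity>"
      by (simp add: D_def ennreal_suminf_neq_top)
    moreover have "(\<integral>\<^sup>+\<omega>. (\<Sum>j. ennreal (D j \<omega>)) \<partial>M) = (\<Sum>j. ennreal (expectation (D j)))"
    proof -
      have "(\<integral>\<^sup>+\<omega>. ennreal (D j \<omega>) \<partial>M) = ennreal (expectation (D j))" for j
        by (rule nn_integral_eq_integral[OF D_int]) (simp add: D_def)
      moreover have "(\<lambda>\<omega>. ennreal (D j \<omega>)) \<in> borel_measurable M" for j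
        unfolding D_def by measurable
      ultimately show ?thesis by (simp add: nn_integral_suminf)
    qed
    ultimately show "(\<integral>\<^sup>+\<omega>. (\<Sum>j. ennreal (D j \<omega>)) \<partial>M) \<noteq> \<infinity>" by simp
  qed (simp add: D_def)
  then have conv: "AE \<omega> in M. (\<lambda>k. X k \<omega>) \<longlonglongrightarrow> lim (\<lambda>k. X k \<omega>)"
  proof eventually_elim
    case (elim \<omega>)
    then have "summable (\<lambda>j. D j \<omega>)"
      by (intro summable_suminf_not_top) (auto simp: D_def)
    then have "summable (\<lambda>j. X (Suc j) \<omega> - X j \<omega>)"
      unfolding D_def by (rule summable_rabs_cancel)
    then have "convergent (\<lambda>n. X 0 \<omega> + (\<Sum>j<n. X (Suc j) \<omega> - X j \<omega>))"
      by (intro convergent_add convergent_const) (simp add: summable_iff_convergent)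
    then show ?case
      using sum_lessThan_telescope[of "\<lambda>j. X j \<omega>"] by (simp add: convergent_LIMSEQ_iff)
  qed
  define Y where "Y \<omega> = lim (\<lambda>k. X k \<omega>)" for \<omega>
  have Y[measurable]: "Y \<in> borel_measurable M"
    unfolding Y_def by measurable
  have XY: "integrable M (\<lambda>\<omega>. (X k \<omega> - Y \<omega>)\<^sup>2)" "expectation (\<lambda>\<omega>. (X k \<omega> - Y \<omega>)\<^sup>2) \<le> C * (1 / 4) ^ k" for k
  proof -
    have lim: "AE \<omega> in M. (\<lambda>m. (X k \<omega> - X m \<omega>)\<^sup>2) \<longlonglongrightarrow> (X k \<omega> - Y \<omega>)\<^sup>2"
      using conv unfolding Y_def by eventually_elim (intro tendsto_intros)
    have int: "integrable M (\<lambda>\<omega>. (X k \<omega> - X m \<omega>)\<^sup>2)" for m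
      using square_integrable_diff[OF X X] by (simp add: square_integrable_def)
    have ev: "eventually (\<lambda>m. expectation (\<lambda>\<omega>. (X k \<omega> - X m \<omega>)\<^sup>2) \<le> C * (1 / 4) ^ k) sequentially"
      by (rule eventually_mono[OF eventually_ge_at_top[of k] bound])
    have meas: "(\<lambda>\<omega>. (X k \<omega> - Y \<omega>)\<^sup>2) \<in> borel_measurable M" by measurable
    show "integrable M (\<lambda>\<omega>. (X k \<omega> - Y \<omega>)\<^sup>2)" "expectation (\<lambda>\<omega>. (X k \<omega> - Y \<omega>)\<^sup>2) \<le> C * (1 / 4) ^ k"
      by (rule integral_le_of_AE_tendsto[OF int _ meas _ lim ev]; simp)+
  qed
  show thesis
  proof
    have "square_integrable M (\<lambda>\<omega>. X 0 \<omega> - Y \<omega>)"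
      using XY(1)[of 0] by (simp add: square_integrable_def)
    from square_integrable_diff[OF X[of 0] this] show "square_integrable M Y" by simp
    have "(\<lambda>k. C * (1 / 4) ^ k) \<longlonglongrightarrow> C * 0"
      by (intro tendsto_intros LIMSEQ_power_zero) simp
    then show "(\<lambda>k. expectation (\<lambda>\<omega>. (X k \<omega> - Y \<omega>)\<^sup>2)) \<longlonglongrightarrow> 0"
      by (intro LIMSEQ_zero_of_le[OF _ XY(2)]) simp_all
  qed
qed

section \<open>Absolutely continuous functions\<close>

lemma abs_continuous_on_subset:
  "abs_continuous_on S h \<Longrightarrow> T \<subseteq> S \<Longrightarrow> abs_continuous_on T h"
  unfolding abs_continuous_on_def by (meson subset_trans)

text \<open>
  The fundamental theorem of calculus when the derivative exists only outside a null set \<open>N\<close>.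
  In a Henstock--Kurzweil sum, the intervals tagged outside \<open>N\<close> are controlled by
  differentiability at the tag, as in the classical proof. The gauge confines the intervals tagged in
  \<open>N\<close> to an open set of small measure around \<open>N\<close>, so absolute continuity makes the total increment of
  \<open>h\<close> over them small. The integrand is first set to \<open>0\<close> on \<open>N\<close>, where its values are arbitrary.
\<close>

lemma has_integral_derivative_abs_continuous_on:
  fixes h h' :: "real \<Rightarrow> real"
  assumes ab: "a \<le> b" and ac: "abs_continuous_on {a..b} h"
    and N: "negligible N"
    and deriv: "\<And>x. x \<in> {a..b} - N \<Longrightarrow> (h has_vector_derivative h' x) (at x within {a..b})"
  shows "(h' has_integral (h b - h a)) {a..b}"
proof (cases "a = b")
  case False
  with ab have "a < b" by simp
  define g where "g x = (if x \<in> N then 0 else h' x)" for x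
  have "(g has_integral (h b - h a)) {a..b}"
    unfolding has_integral_real
  proof (intro allI impI)
    fix e :: real assume "0 < e"
    \<comment> \<open>The intervals tagged outside \<open>N\<close> contribute at most \<open>e / 4\<close> in total, the others less than \<open>e / 2\<close>.\<close>
    define e1 where "e1 = e / 4 / (b - a)"
    have "0 < e1" using \<open>0 < e\<close> \<open>a < b\<close> by (simp add: e1_def)
    have "0 < e / 2" using \<open>0 < e\<close> by simp
    with ac obtain \<delta> where "0 < \<delta>" and \<delta>: "\<forall>(n::nat) (u::nat \<Rightarrow> real) (v::nat \<Rightarrow> real).
        (\<forall>i<n. u i \<le> v i \<and> {u i..v i} \<subseteq> {a..b}) \<and>
        disjoint_family_on (\<lambda>i. {u i<..<v i}) {..<n} \<and>
        (\<Sum>i<n. v i - u i) < \<delta> \<longrightarrow> (\<Sum>i<n. \<bar>h (v i) - h (u i)\<bar>) < e / 2"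
      unfolding abs_continuous_on_def by blast
    have N0: "N \<in> null_sets lebesgue" using N by (simp add: negligible_iff_null_sets)
    then have "N \<in> sets lebesgue" by blast
    then obtain U where U: "open U" "N \<subseteq> U" "U - N \<in> lmeasurable" "emeasure lebesgue (U - N) < ennreal \<delta>"
      using sets_lebesgue_outer_open[OF _ \<open>0 < \<delta>\<close>] by blast
    have Um: "U \<in> sets lebesgue" using \<open>open U\<close> by auto
    have eU: "emeasure lebesgue U < ennreal \<delta>"
      using U(4) emeasure_Diff_null_set[OF N0 Um] by simp
    have U_lm: "U \<in> lmeasurable"
      using Um eU by (auto simp: fmeasurable_def intro: order.strict_trans)
    then have U_less: "measure lebesgue U < \<delta>"
      using eU by (simp add: emeasure_eq_measure2 ennreal_less_iff)
    have "\<forall>x. \<exists>d>0. x \<in> {a..b} - N \<longrightarrow>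
        (\<forall>y\<in>{a..b}. norm (y - x) < d \<longrightarrow> norm (h y - h x - (y - x) *\<^sub>R h' x) \<le> e1 * norm (y - x))"
      using deriv[unfolded has_vector_derivative_def has_derivative_within_alt] \<open>0 < e1\<close>
      by (meson zero_less_one)
    then obtain d where d: "\<And>x. 0 < d x"
      "\<And>x y. \<lbrakk>x \<in> {a..b} - N; y \<in> {a..b}; norm (y - x) < d x\<rbrakk>
         \<Longrightarrow> norm (h y - h x - (y - x) *\<^sub>R h' x) \<le> e1 * norm (y - x)"
      by metis
    define \<gamma> where "\<gamma> x = (if x \<in> N then U else ball x (d x))" for x
    show "\<exists>\<gamma>. gauge \<gamma> \<and> (\<forall>\<D>. \<D> tagged_division_of {a..b} \<and> \<gamma> fine \<D> \<longrightarrow>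
        norm ((\<Sum>(x, K)\<in>\<D>. measure lborel K *\<^sub>R g x) - (h b - h a)) < e)"
    proof (intro exI[of _ \<gamma>] conjI allI impI; (elim conjE)?)
      show "gauge \<gamma>"
        using U d(1) by (auto simp: gauge_def \<gamma>_def)
    next
      fix p assume p: "p tagged_division_of {a..b}" and fine: "\<gamma> fine p"
      define r where "r = (\<lambda>(x, K). measure lborel K *\<^sub>R g x - (h (Sup K) - h (Inf K)))"
      define P where "P = {(x, K) \<in> p. x \<in> N}"
      have "finite p" using p by blast
      have "finite P" "P \<subseteq> p" using \<open>finite p\<close> by (auto simp: P_def intro: finite_subset)
      have K: "\<exists>u v. K = {u..v} \<and> u \<le> v \<and> u \<le> x \<and> x \<le> v \<and> a \<le> u \<and> v \<le> b \<and> Inf K = u \<and> Sup K = v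
          \<and> measure lborel K = v - u \<and> interior K = {u<..<v} \<and> K \<subseteq> \<gamma> x" if xK: "(x, K) \<in> p" for x K
      proof -
        obtain u v where "K = cbox u v" "x \<in> K" "K \<subseteq> {a..b}"
          using tagged_division_ofD(2-4)[OF p xK] by blast
        moreover have "K \<subseteq> \<gamma> x" using fine xK by (auto simp: fine_def)
        ultimately show ?thesis by (intro exI[of _ u] exI[of _ v]) auto
      qed
      have good: "\<bar>r z\<bar> \<le> e1 * measure lborel (snd z)" if "z \<in> p - P" for z
      proof -
        obtain x K where z: "z = (x, K)" by (cases z)
        with that have "(x, K) \<in> p" "x \<notin> N" by (auto simp: P_def)
        with K obtain u v where uv: "K = {u..v}" "u \<le> v" "u \<le> x" "x \<le> v" "a \<le> u" "v \<le> b"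
          "Inf K = u" "Sup K = v" "measure lborel K = v - u" "K \<subseteq> \<gamma> x" by metis
        have "u \<in> \<gamma> x" "v \<in> \<gamma> x" using uv by auto
        then have "\<bar>h u - h x - (u - x) * h' x\<bar> \<le> e1 * \<bar>u - x\<bar>" "\<bar>h v - h x - (v - x) * h' x\<bar> \<le> e1 * \<bar>v - x\<bar>"
          using d(2)[of x u] d(2)[of x v] \<open>x \<notin> N\<close> uv by (auto simp: \<gamma>_def dist_real_def abs_minus_commute)
        moreover have "e1 * \<bar>u - x\<bar> + e1 * \<bar>v - x\<bar> = e1 * (v - u)"
          using uv by (simp add: algebra_simps)
        moreover have "r z = (h u - h x - (u - x) * h' x) - (h v - h x - (v - x) * h' x)"
          using uv \<open>x \<notin> N\<close> by (simp add: r_def z g_def algebra_simps)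
        ultimately show ?thesis using uv z by simp
      qed
      have bad: "(\<Sum>z\<in>P. \<bar>r z\<bar>) < e / 2"
      proof -
        obtain q where q: "bij_betw q {..<card P} P"
          using ex_bij_betw_nat_finite[OF \<open>finite P\<close>] by (auto simp: atLeast0LessThan)
        define u v where "u i = Inf (snd (q i))" and "v i = Sup (snd (q i))" for i
        have qP: "q i \<in> P" if "i < card P" for i
          using bij_betw_apply[OF q] that by simp
        have q_props: "u i \<le> v i \<and> {u i..v i} \<subseteq> {a..b} \<and> interior (snd (q i)) = {u i<..<v i}
            \<and> {u i<..<v i} \<subseteq> U \<and> \<bar>r (q i)\<bar> = \<bar>h (v i) - h (u i)\<bar>"
          if "i < card P" for i
        proof -
          obtain x L where z: "q i = (x, L)" by (cases "q i")
          then have "(x, L) \<in> p" "x \<in> N" using qP[OF that] by (auto simp: P_def)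
          from K[OF this(1)] obtain u' v' where "L = {u'..v'}" "u' \<le> v'" "a \<le> u'" "v' \<le> b"
            "Inf L = u'" "Sup L = v'" "interior L = {u'<..<v'}" "L \<subseteq> \<gamma> x" by blast
          with \<open>x \<in> N\<close> show ?thesis
            by (auto simp: u_def v_def z r_def g_def \<gamma>_def)
        qed
        have disj: "disjoint_family_on (\<lambda>i. {u i<..<v i}) {..<card P}"
          unfolding disjoint_family_on_def
        proof (intro ballI impI)
          fix i j assume ij: "i \<in> {..<card P}" "j \<in> {..<card P}" "i \<noteq> j"
          then have "q i \<noteq> q j" using q by (auto simp: bij_betw_def inj_on_def)
          moreover have "q i \<in> p" "q j \<in> p" using ij qP \<open>P \<subseteq> p\<close> by auto
          ultimately have "interior (snd (q i)) \<inter> interior (snd (q j)) = {}"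
            using tagged_division_ofD(5)[OF p, of "fst (q i)" "snd (q i)" "fst (q j)" "snd (q j)"] by simp
          then show "{u i<..<v i} \<inter> {u j<..<v j} = {}" using q_props ij by simp
        qed
        have "(\<Sum>i<card P. v i - u i) = (\<Sum>i<card P. measure lebesgue {u i<..<v i})"
          using q_props by (intro sum.cong) auto
        also have "\<dots> = measure lebesgue (\<Union>i<card P. {u i<..<v i})"
          using disj by (intro measure_UNION'[symmetric])
            (auto simp: disjoint_family_on_def pairwise_def disjnt_def)
        also have "\<dots> \<le> measure lebesgue U"
          using q_props U_lm by (intro measure_mono_fmeasurable) (auto intro!: sets.finite_UN)
        finally have "(\<Sum>i<card P. v i - u i) < \<delta>" using U_less by simp
        then have "(\<Sum>i<card P. \<bar>h (v i) - h (u i)\<bar>) < e / 2"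
          using q_props disj by (intro \<delta>[THEN spec, THEN spec, THEN spec, THEN mp]) auto
        also have "(\<Sum>i<card P. \<bar>h (v i) - h (u i)\<bar>) = (\<Sum>i<card P. \<bar>r (q i)\<bar>)"
          using q_props by (intro sum.cong) auto
        also have "\<dots> = (\<Sum>z\<in>P. \<bar>r z\<bar>)"
          by (rule sum.reindex_bij_betw[OF q])
        finally show ?thesis .
      qed
      have "(\<Sum>(x, K)\<in>p. measure lborel K *\<^sub>R g x) - (h b - h a) = (\<Sum>z\<in>p. r z)"
        using additive_tagged_division_1[OF ab p, of h]
        by (simp add: r_def sum_subtractf case_prod_unfold)
      also have "\<bar>\<dots>\<bar> \<le> (\<Sum>z\<in>p. \<bar>r z\<bar>)" by (rule sum_abs)
      also have "\<dots> = (\<Sum>z\<in>p - P. \<bar>r z\<bar>) + (\<Sum>z\<in>P. \<bar>r z\<bar>)"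
        using \<open>finite p\<close> \<open>P \<subseteq> p\<close> by (simp add: sum.subset_diff)
      also have "(\<Sum>z\<in>p - P. \<bar>r z\<bar>) \<le> (\<Sum>z\<in>p - P. e1 * measure lborel (snd z))"
        by (rule sum_mono) (rule good)
      also have "\<dots> \<le> (\<Sum>z\<in>p. e1 * measure lborel (snd z))"
        using \<open>finite p\<close> \<open>0 < e1\<close> by (intro sum_mono2) auto
      also have "\<dots> = e1 * (b - a)"
        using additive_content_tagged_division[of p a b] p ab
        by (simp add: sum_distrib_left[symmetric] case_prod_unfold)
      also have "\<dots> = e / 4" using \<open>a < b\<close> by (simp add: e1_def field_simps)
      finally show "norm ((\<Sum>(x, K)\<in>p. measure lborel K *\<^sub>R g x) - (h b - h a)) < e"
        using bad \<open>0 < e\<close> by simp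
    qed
  qed
  then show ?thesis
    by (rule has_integral_spike[OF N, rotated]) (auto simp: g_def)
qed auto

section \<open>Brownian increments and step integrals\<close>

text \<open>
  Completing the square: tilting a centred Gaussian density by \<open>exp (c * x)\<close> shifts its mean.
\<close>

lemma normal_density_times_exp:
  assumes "0 < \<sigma>"
  shows "normal_density 0 \<sigma> x * exp (c * x) =
    exp (c\<^sup>2 * \<sigma>\<^sup>2 / 2) * normal_density (c * \<sigma>\<^sup>2) \<sigma> x"
proof -
  have "- x\<^sup>2 / (2 * \<sigma>\<^sup>2) + c * x = c\<^sup>2 * \<sigma>\<^sup>2 / 2 + - (x - c * \<sigma>\<^sup>2)\<^sup>2 / (2 * \<sigma>\<^sup>2)"
    using assms by (simp add: field_simps power2_eq_square)
  then show ?thesis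
    by (simp add: normal_density_def flip: exp_add)
qed

locale brownian_motion = prob_space M for M :: "'a measure" +
  fixes B :: "real \<Rightarrow> 'a \<Rightarrow> real"
  assumes BM: "standard_brownian_motion M B"
begin

lemma measurable_B [measurable (raw)]: "0 \<le> t \<Longrightarrow> B t \<in> borel_measurable M"
  using BM by (auto simp: standard_brownian_motion_def)

lemma B_0: "AE \<omega> in M. B 0 \<omega> = 0"
  using BM by (auto simp: standard_brownian_motion_def)

lemma indep_increments:
  assumes "0 \<le> \<tau> 0" "\<And>i. i < n \<Longrightarrow> \<tau> i \<le> \<tau> (Suc i)"
  shows "indep_vars (\<lambda>_. borel) (\<lambda>i \<omega>. B (\<tau> (Suc i)) \<omega> - B (\<tau> i) \<omega>) {..<n}"
  using BM assms by (auto simp: standard_brownian_motion_def)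

lemma distributed_increment:
  "0 \<le> s \<Longrightarrow> s < t \<Longrightarrow>
    distributed M lborel (\<lambda>\<omega>. B t \<omega> - B s \<omega>) (normal_density 0 (sqrt (t - s)))"
  using BM by (auto simp: standard_brownian_motion_def)

lemma exp_increment:
  assumes "0 \<le> s" "s \<le> t"
  shows integrable_exp_increment: "integrable M (\<lambda>\<omega>. exp (c * (B t \<omega> - B s \<omega>)))" (is ?i)
    and expectation_exp_increment:
      "expectation (\<lambda>\<omega>. exp (c * (B t \<omega> - B s \<omega>))) = exp (c\<^sup>2 * (t - s) / 2)" (is ?e)
proof -
  have "?i \<and> ?e"
  proof (cases "s = t")
    case False
    with assms have st: "s < t" by simp
    note D = distributed_increment[OF \<open>0 \<le> s\<close> st]
    have *: "normal_density 0 (sqrt (t - s)) x * exp (c * x) =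
        exp (c\<^sup>2 * (t - s) / 2) * normal_density (c * (t - s)) (sqrt (t - s)) x" for x
      using normal_density_times_exp[of "sqrt (t - s)" x c] st by simp
    have "integrable lborel (\<lambda>x. normal_density 0 (sqrt (t - s)) x * exp (c * x))"
      unfolding * using st by simp
    moreover have "(\<integral>x. normal_density 0 (sqrt (t - s)) x * exp (c * x) \<partial>lborel) = exp (c\<^sup>2 * (t - s) / 2)"
      unfolding * using st by simp
    ultimately show ?thesis
      using distributed_integrable[OF D, of "\<lambda>x. exp (c * x)"]
        distributed_integral[OF D, of "\<lambda>x. exp (c * x)"] by simp
  qed (simp add: prob_space)
  then show ?i ?e by auto
qed

lemma increment_moments:
  assumes "0 \<le> s" "s \<le> t"
  shows square_integrable_increment: "square_integrable M (\<lambda>\<omega>. B t \<omega> - B s \<omega>)" (is ?i)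
    and expectation_increment: "expectation (\<lambda>\<omega>. B t \<omega> - B s \<omega>) = 0" (is ?e)
    and expectation_increment_square: "expectation (\<lambda>\<omega>. (B t \<omega> - B s \<omega>)\<^sup>2) = t - s" (is ?v)
proof -
  have "?i \<and> ?e \<and> ?v"
  proof (cases "s = t")
    case False
    with assms have st: "s < t" by simp
    note D = distributed_increment[OF \<open>0 \<le> s\<close> st]
    have "integrable M (\<lambda>\<omega>. (B t \<omega> - B s \<omega>)\<^sup>2)"
      using distributed_integrable[OF D, of "\<lambda>x. x\<^sup>2"]
        integrable_normal_moment[of "sqrt (t - s)" 0 2] st by simp
    moreover have e: ?e
      using normal_distributed_expectation[OF _ D] st by simp
    moreover have ?v
      using normal_distributed_variance[OF _ D] st by (simp add: e)
    ultimately show ?thesis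
      using assms by (auto simp: square_integrable_def)
  qed (simp add: square_integrable_def)
  then show ?i ?e ?v by auto
qed

lemma square_integrable_B: "0 \<le> t \<Longrightarrow> square_integrable M (B t)"
  using B_0 by (intro square_integrable_cong_AE[OF square_integrable_increment[of 0 t]]) auto

text \<open>
  The partition \<open>0, s, t\<close> exhibits \<open>B\<^sub>s - B\<^sub>0\<close> and \<open>B\<^sub>t - B\<^sub>s\<close> as independent increments, the second centred.
\<close>

lemma expectation_B_mult_increment:
  assumes "0 \<le> s" "s \<le> t"
  shows "expectation (\<lambda>\<omega>. B s \<omega> * (B t \<omega> - B s \<omega>)) = 0"
proof -
  define \<tau> where "\<tau> i = (if i = 0 then 0 else if i = 1 then s else t)" for i :: nat
  let ?X = "\<lambda>i \<omega>. B (\<tau> (Suc i)) \<omega> - B (\<tau> i) \<omega>"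
  have "indep_vars (\<lambda>_. borel) ?X {..<2}"
    using assms by (intro indep_increments) (auto simp: \<tau>_def)
  moreover have "integrable M (?X i)" if "i \<in> {..<2}" for i
  proof -
    have "square_integrable M (?X i)"
      using assms by (intro square_integrable_increment) (auto simp: \<tau>_def)
    then show ?thesis
      by (auto simp: square_integrable_def intro: square_integrable_imp_integrable)
  qed
  ultimately have "expectation (\<lambda>\<omega>. \<Prod>i\<in>{..<2}. ?X i \<omega>) = (\<Prod>i\<in>{..<2}. expectation (?X i))"
    by (intro indep_vars_lebesgue_integral) auto
  also have "\<dots> = 0"
    using expectation_increment[of s t] assms by (simp add: numeral_2_eq_2 \<tau>_def)
  finally have "expectation (\<lambda>\<omega>. (B s \<omega> - B 0 \<omega>) * (B t \<omega> - B s \<omega>)) = 0"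
    by (simp add: numeral_2_eq_2 \<tau>_def)
  also have "expectation (\<lambda>\<omega>. (B s \<omega> - B 0 \<omega>) * (B t \<omega> - B s \<omega>)) =
      expectation (\<lambda>\<omega>. B s \<omega> * (B t \<omega> - B s \<omega>))"
    using B_0 assms by (intro integral_cong_AE) auto
  finally show ?thesis .
qed

lemma expectation_B_mult_B:
  assumes "0 \<le> s" "0 \<le> t"
  shows "expectation (\<lambda>\<omega>. B s \<omega> * B t \<omega>) = min s t"
proof -
  have *: "expectation (\<lambda>\<omega>. B s \<omega> * B t \<omega>) = s" if "0 \<le> s" "s \<le> t" for s t
  proof -
    have sq: "square_integrable M (B s)" "square_integrable M (B t)"
      using that by (auto intro!: square_integrable_B)
    have "expectation (\<lambda>\<omega>. B s \<omega> * B s \<omega>) = expectation (\<lambda>\<omega>. (B s \<omega> - B 0 \<omega>)\<^sup>2)"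
      using B_0 that by (intro integral_cong_AE) (auto simp: power2_eq_square)
    also have "\<dots> = s"
      using expectation_increment_square[of 0 s] that by simp
    finally show ?thesis
      using expectation_B_mult_increment[OF that] sq
      by (simp add: right_diff_distrib square_integrable_mult)
  qed
  show ?thesis
    using *[of s t] *[of t s] assms by (cases "s \<le> t") (auto simp: mult.commute)
qed

text \<open>
  The Ito isometry for two single intervals, which may overlap. The covariance
  \<open>E(B\<^sub>s B\<^sub>t) = min s t\<close> reduces both sides to the length of the intersection.
\<close>

lemma expectation_increment_mult_increment:
  assumes "0 \<le> a" "a \<le> b" "b \<le> t" "0 \<le> c" "c \<le> d" "d \<le> t"
  shows "expectation (\<lambda>\<omega>. (B b \<omega> - B a \<omega>) * (B d \<omega> - B c \<omega>)) =
    (\<integral>x. indicator {a<..b} x * indicator {c<..d} x \<partial>restrict_space lborel {0..t})"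
proof -
  have sq: "square_integrable M (B a)" "square_integrable M (B b)"
      "square_integrable M (B c)" "square_integrable M (B d)"
    using assms by (auto intro!: square_integrable_B)
  have "expectation (\<lambda>\<omega>. (B b \<omega> - B a \<omega>) * (B d \<omega> - B c \<omega>)) =
      expectation (\<lambda>\<omega>. B b \<omega> * B d \<omega> - B a \<omega> * B d \<omega> - (B b \<omega> * B c \<omega> - B a \<omega> * B c \<omega>))"
    by (simp add: algebra_simps)
  also have "\<dots> = min b d - min a d - (min b c - min a c)"
    using sq assms by (simp add: square_integrable_mult expectation_B_mult_B)
  also have "\<dots> = measure lborel {max a c<..min b d}"
    using assms by (auto simp: min_def max_def)
  also have "\<dots> = (\<integral>x. indicator {max a c<..min b d} x \<partial>lborel)"
    by simp
  also have "\<dots> = (\<integral>x. indicator {0..t} x *\<^sub>R (indicator {a<..b} x * indicator {c<..d} x) \<partial>lborel)"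
    using assms by (intro Bochner_Integration.integral_cong) (auto simp: indicator_def)
  also have "\<dots> = (\<integral>x. indicator {a<..b} x * indicator {c<..d} x \<partial>restrict_space lborel {0..t})"
    by (rule integral_restrict_space[symmetric]) simp
  finally show ?thesis .
qed

end

lemma step_on_mono:
  assumes "step_on t (n, \<tau>, c)" "i \<le> j" "j \<le> n"
  shows "\<tau> i \<le> \<tau> j"
  using assms(2,3)
proof (induction j rule: dec_induct)
  case (step j)
  then have "\<tau> j \<le> \<tau> (Suc j)" using assms by (auto simp: step_on_def)
  with step show ?case by auto
qed simp

lemma step_on_bounds:
  assumes "step_on t (n, \<tau>, c)" "i \<le> n"
  shows "0 \<le> \<tau> i" "\<tau> i \<le> t"
  using step_on_mono[OF assms(1), of 0 i] step_on_mono[OF assms(1), of i n] assms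
  by (auto simp: step_on_def)

text \<open>
  The intervals are disjoint, so the mixed terms of the square vanish. The squared indicators are
  kept as products to match the covariance of increments.
\<close>

lemma step_fun_power2:
  assumes "step_on t (n, \<tau>, c)"
  shows "(step_fun (n, \<tau>, c) x)\<^sup>2 =
    (\<Sum>i<n. (c i)\<^sup>2 * (indicator {\<tau> i<..\<tau> (Suc i)} x * indicator {\<tau> i<..\<tau> (Suc i)} x))"
proof -
  let ?I = "\<lambda>i. indicator {\<tau> i<..\<tau> (Suc i)} x :: real"
  have disj: "?I i * ?I j = 0" if "i < j" "j < n" for i j
    using step_on_mono[OF assms, of "Suc i" j] that by (auto simp: indicator_def)
  have "?I i * ?I j = 0" if "i \<noteq> j" "i < n" "j < n" for i j
    using disj[of i j] disj[of j i] that by (auto simp: mult.commute neq_iff)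
  then have eq: "c i * ?I i * (c j * ?I j) = (if i = j then (c i)\<^sup>2 * (?I i * ?I i) else 0)"
    if "i < n" "j < n" for i j
    using that by (auto simp: power2_eq_square)
  have "(step_fun (n, \<tau>, c) x)\<^sup>2 = (\<Sum>i<n. \<Sum>j<n. c i * ?I i * (c j * ?I j))"
    unfolding step_fun_def prod.case power2_eq_square sum_product ..
  also have "\<dots> = (\<Sum>i<n. \<Sum>j<n. if i = j then (c i)\<^sup>2 * (?I i * ?I i) else 0)"
    by (intro sum.cong refl eq) auto
  also have "\<dots> = (\<Sum>i<n. (c i)\<^sup>2 * (?I i * ?I i))"
    by simp
  finally show ?thesis .
qed

lemma square_integrable_indicator:
  "square_integrable (restrict_space lborel {0..t}) (indicator {a<..b} :: real \<Rightarrow> real)"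
proof -
  have "integrable lborel (\<lambda>x. indicator {0..t} x *\<^sub>R ((indicator {a<..b} x)\<^sup>2 :: real))"
  proof (rule Bochner_Integration.integrable_bound)
    show "integrable lborel (indicator {0..t} :: real \<Rightarrow> real)"
      by (rule integrable_real_indicator) (auto simp: emeasure_lborel_Icc_eq)
  qed (auto simp: indicator_def)
  then show ?thesis
    by (auto simp: square_integrable_def integrable_restrict_space intro!: measurable_restrict_space1)
qed

lemma square_integrable_step_fun:
  "square_integrable (restrict_space lborel {0..t}) (step_fun \<phi>)"
  by (cases \<phi>, simp only: step_fun_def prod.case)
    (intro square_integrable_sum square_integrable_cmult square_integrable_indicator)

context brownian_motion
begin

lemma square_integrable_step_integral:
  assumes "step_on t \<phi>"
  shows "square_integrable M (step_integral B \<phi>)"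
proof (cases \<phi>)
  case (fields n \<tau> c)
  with assms show ?thesis
    using step_on_bounds step_on_mono
    by (simp only: step_integral_def prod.case)
      (intro square_integrable_sum square_integrable_cmult square_integrable_increment; simp)
qed

text \<open>
  The partitions of the two step functions may be unrelated. Expanding both sums reduces the
  claim to pairs of intervals.
\<close>

lemma step_integral_isometry:
  assumes "step_on t \<phi>" "step_on t \<psi>"
  shows "expectation (\<lambda>\<omega>. step_integral B \<phi> \<omega> * step_integral B \<psi> \<omega>) =
    (\<integral>x. step_fun \<phi> x * step_fun \<psi> x \<partial>restrict_space lborel {0..t})"
proof -
  obtain n \<tau> c where \<phi>: "\<phi> = (n, \<tau>, c)" by (cases \<phi>)
  obtain m \<rho> d where \<psi>: "\<psi> = (m, \<rho>, d)" by (cases \<psi>)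
  note b = step_on_bounds[OF assms(1)[unfolded \<phi>]] step_on_mono[OF assms(1)[unfolded \<phi>]]
    step_on_bounds[OF assms(2)[unfolded \<psi>]] step_on_mono[OF assms(2)[unfolded \<psi>]]
  have i: "integrable M (\<lambda>\<omega>. (B (\<tau> (Suc i)) \<omega> - B (\<tau> i) \<omega>) * (B (\<rho> (Suc j)) \<omega> - B (\<rho> j) \<omega>))"
    if "i < n" "j < m" for i j
    using b that by (intro square_integrable_mult square_integrable_increment) auto
  have "expectation (\<lambda>\<omega>. step_integral B \<phi> \<omega> * step_integral B \<psi> \<omega>) =
      expectation (\<lambda>\<omega>. \<Sum>i<n. \<Sum>j<m. c i * d j * ((B (\<tau> (Suc i)) \<omega> - B (\<tau> i) \<omega>) * (B (\<rho> (Suc j)) \<omega> - B (\<rho> j) \<omega>)))"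
    by (simp add: \<phi> \<psi> step_integral_def sum_product mult_ac)
  also have "\<dots> = (\<Sum>i<n. \<Sum>j<m. c i * d j *
      expectation (\<lambda>\<omega>. (B (\<tau> (Suc i)) \<omega> - B (\<tau> i) \<omega>) * (B (\<rho> (Suc j)) \<omega> - B (\<rho> j) \<omega>)))"
  proof (subst Bochner_Integration.integral_sum)
    show "integrable M (\<lambda>\<omega>. \<Sum>j<m. c i * d j * ((B (\<tau> (Suc i)) \<omega> - B (\<tau> i) \<omega>) * (B (\<rho> (Suc j)) \<omega> - B (\<rho> j) \<omega>)))"
      if "i \<in> {..<n}" for i
      using that i by (intro Bochner_Integration.integrable_sum integrable_mult_right) auto
  qed (use i in \<open>auto intro!: sum.cong simp: Bochner_Integration.integral_sum\<close>)
  also have "\<dots> = (\<Sum>i<n. \<Sum>j<m. c i * d j *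
      (\<integral>x. indicator {\<tau> i<..\<tau> (Suc i)} x * indicator {\<rho> j<..\<rho> (Suc j)} x \<partial>restrict_space lborel {0..t}))"
    using b by (intro sum.cong refl arg_cong2[where f="(*)"] expectation_increment_mult_increment) auto
  also have "\<dots> = (\<integral>x. (\<Sum>i<n. \<Sum>j<m. c i * d j *
      (indicator {\<tau> i<..\<tau> (Suc i)} x * indicator {\<rho> j<..\<rho> (Suc j)} x)) \<partial>restrict_space lborel {0..t})"
    by (simp add: Bochner_Integration.integral_sum square_integrable_mult square_integrable_indicator)
  also have "\<dots> = (\<integral>x. step_fun \<phi> x * step_fun \<psi> x \<partial>restrict_space lborel {0..t})"
    by (simp only: \<phi> \<psi> step_fun_def prod.case sum_product mult_ac)
  finally show ?thesis .
qed

lemma step_integral_isometry_diff: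
  assumes "step_on t \<phi>" "step_on t \<psi>"
  shows "expectation (\<lambda>\<omega>. (step_integral B \<phi> \<omega> - step_integral B \<psi> \<omega>)\<^sup>2) =
    (\<integral>x. (step_fun \<phi> x - step_fun \<psi> x)\<^sup>2 \<partial>restrict_space lborel {0..t})"
proof -
  have sq: "(x - y)\<^sup>2 = x * x - x * y - (x * y - y * y)" for x y :: real
    by (simp add: power2_eq_square algebra_simps)
  note i = square_integrable_mult[OF square_integrable_step_integral square_integrable_step_integral]
  note j = square_integrable_mult[OF square_integrable_step_fun square_integrable_step_fun]
  show ?thesis
    unfolding sq
    by (simp add: i[OF assms(1,1)] i[OF assms(1,2)] i[OF assms(2,2)] j step_integral_isometry[OF assms(1,1)]
      step_integral_isometry[OF assms(1,2)] step_integral_isometry[OF assms(2,2)])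
qed

text \<open>
  The increments belonging to one partition are independent, so the expectation factorises; as the
  intervals are disjoint, the exponents add up to \<open>a\<^sup>2/2\<close> times the integral of the squared step
  function.
\<close>

lemma exp_step_integral:
  assumes "step_on t \<phi>"
  shows integrable_exp_step_integral: "integrable M (\<lambda>\<omega>. exp (a * step_integral B \<phi> \<omega>))" (is ?i)
    and expectation_exp_step_integral:
      "expectation (\<lambda>\<omega>. exp (a * step_integral B \<phi> \<omega>)) =
        exp (a\<^sup>2 / 2 * (\<integral>x. (step_fun \<phi> x)\<^sup>2 \<partial>restrict_space lborel {0..t}))" (is ?e)
proof -
  obtain n \<tau> c where \<phi>: "\<phi> = (n, \<tau>, c)" by (cases \<phi>)
  note b = step_on_bounds[OF assms(1)[unfolded \<phi>]] step_on_mono[OF assms(1)[unfolded \<phi>]]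
  let ?X = "\<lambda>i \<omega>. exp (a * c i * (B (\<tau> (Suc i)) \<omega> - B (\<tau> i) \<omega>))"
  have eq: "exp (a * step_integral B \<phi> \<omega>) = (\<Prod>i<n. ?X i \<omega>)" for \<omega>
    by (simp add: \<phi> step_integral_def exp_sum sum_distrib_left mult.assoc)
  have "indep_vars (\<lambda>_. borel) (\<lambda>i \<omega>. B (\<tau> (Suc i)) \<omega> - B (\<tau> i) \<omega>) {..<n}"
    using b by (intro indep_increments) auto
  then have ind: "indep_vars (\<lambda>_. borel) ?X {..<n}"
    by (rule indep_vars_compose2) auto
  have X: "integrable M (?X i)" if "i \<in> {..<n}" for i
    using that b by (intro integrable_exp_increment) auto
  show ?i
    unfolding eq by (rule indep_vars_integrable[OF _ ind X]) auto
  have "(\<integral>x. (step_fun \<phi> x)\<^sup>2 \<partial>restrict_space lborel {0..t}) =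
      (\<integral>x. (\<Sum>i<n. (c i)\<^sup>2 * (indicator {\<tau> i<..\<tau> (Suc i)} x * indicator {\<tau> i<..\<tau> (Suc i)} x))
        \<partial>restrict_space lborel {0..t})"
    by (simp only: \<phi> step_fun_power2[OF assms[unfolded \<phi>]])
  also have "\<dots> = (\<Sum>i<n. (c i)\<^sup>2 * expectation (\<lambda>\<omega>. (B (\<tau> (Suc i)) \<omega> - B (\<tau> i) \<omega>) * (B (\<tau> (Suc i)) \<omega> - B (\<tau> i) \<omega>)))"
    using b expectation_increment_mult_increment[symmetric]
    by (subst Bochner_Integration.integral_sum)
      (auto simp: square_integrable_mult square_integrable_indicator intro!: sum.cong)
  also have "\<dots> = (\<Sum>i<n. (c i)\<^sup>2 * (\<tau> (Suc i) - \<tau> i))"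
    using b by (intro sum.cong) (auto simp flip: expectation_increment_square power2_eq_square)
  finally have int: "(\<integral>x. (step_fun \<phi> x)\<^sup>2 \<partial>restrict_space lborel {0..t}) = \<dots>" .
  have "expectation (\<lambda>\<omega>. exp (a * step_integral B \<phi> \<omega>)) = (\<Prod>i<n. expectation (?X i))"
    unfolding eq by (rule indep_vars_lebesgue_integral[OF _ ind X]) auto
  also have "\<dots> = (\<Prod>i<n. exp ((a * c i)\<^sup>2 * (\<tau> (Suc i) - \<tau> i) / 2))"
    using b by (intro prod.cong expectation_exp_increment) auto
  also have "\<dots> = exp (a\<^sup>2 / 2 * (\<Sum>i<n. (c i)\<^sup>2 * (\<tau> (Suc i) - \<tau> i)))"
    by (simp add: sum_distrib_left power_mult_distrib mult_ac flip: exp_sum)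
  finally show ?e using int by simp
qed

end

section \<open>The Wiener integral\<close>

lemma step_fun_eq:
  assumes "step_on t (n, \<tau>, c)" "i < n" "\<tau> i < s" "s \<le> \<tau> (Suc i)"
  shows "step_fun (n, \<tau>, c) s = c i"
proof -
  have "s \<notin> {\<tau> j<..\<tau> (Suc j)}" if "j < n" "j \<noteq> i" for j
    using step_on_mono[OF assms(1), of "Suc i" j] step_on_mono[OF assms(1), of "Suc j" i] assms that
    by (cases "i < j") auto
  then have "step_fun (n, \<tau>, c) s = (\<Sum>j<n. if j = i then c i else 0)"
    unfolding step_fun_def prod.case using assms(3,4) by (intro sum.cong) auto
  then show ?thesis using assms by simp
qed

lemma ex_step_interval:
  fixes \<tau> :: "nat \<Rightarrow> real"
  assumes "\<tau> 0 < s" "s \<le> \<tau> n"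
  shows "\<exists>i<n. \<tau> i < s \<and> s \<le> \<tau> (Suc i)"
  using assms by (induction n) (force simp: less_Suc_eq not_le)+

text \<open>
  The bound excludes \<open>s = 0\<close>, where a step function built from intervals open on the left
  vanishes.
\<close>

lemma ex_uniform_step_approximation:
  fixes f :: "real \<Rightarrow> real"
  assumes f: "continuous_on {0..t} f" and "0 < t" "0 < e"
  shows "\<exists>\<phi>. step_on t \<phi> \<and> (\<forall>s\<in>{0<..t}. \<bar>step_fun \<phi> s - f s\<bar> \<le> e)"
proof -
  have "uniformly_continuous_on {0..t} f"
    using f by (intro compact_uniformly_continuous) auto
  then obtain d where "0 < d" and d: "\<And>x y. x \<in> {0..t} \<Longrightarrow> y \<in> {0..t} \<Longrightarrow> \<bar>y - x\<bar> < d \<Longrightarrow> \<bar>f y - f x\<bar> < e"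
    using \<open>0 < e\<close> unfolding uniformly_continuous_on_def dist_real_def by metis
  obtain n :: nat where n: "t / d < n" using reals_Archimedean2 by blast
  then have "0 < n" using \<open>0 < t\<close> \<open>0 < d\<close> by (cases n) (auto simp: field_simps)
  have tn: "t / n < d" using n \<open>0 < n\<close> \<open>0 < d\<close> by (simp add: field_simps)
  define \<tau> where "\<tau> i = t * (real i / n)" for i
  define \<phi> where "\<phi> = (n, \<tau>, \<lambda>i. f (\<tau> i))"
  have step: "step_on t \<phi>"
    using \<open>0 < t\<close> \<open>0 < n\<close> by (auto simp: \<phi>_def step_on_def \<tau>_def divide_right_mono)
  have "\<bar>step_fun \<phi> s - f s\<bar> \<le> e" if s: "s \<in> {0<..t}" for s
  proof -
    obtain i where i: "i < n" "\<tau> i < s" "s \<le> \<tau> (Suc i)"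
      using ex_step_interval[of \<tau> s n] s \<open>0 < n\<close> by (auto simp: \<tau>_def)
    have "\<tau> (Suc i) = \<tau> i + t / n"
      by (simp add: \<tau>_def add_divide_distrib distrib_left)
    moreover have "0 \<le> \<tau> i" using \<open>0 < t\<close> by (simp add: \<tau>_def)
    ultimately have "\<bar>f (\<tau> i) - f s\<bar> < e"
      using i s tn by (intro d) auto
    then show ?thesis
      using step_fun_eq[OF step[unfolded \<phi>_def] i] by (simp add: \<phi>_def)
  qed
  with step show ?thesis by blast
qed

lemma integral_square_le_of_bound:
  assumes g: "square_integrable (restrict_space lborel {0..t}) g" and "0 \<le> t"
    and le: "\<And>s. s \<in> {0<..t} \<Longrightarrow> \<bar>g s\<bar> \<le> e"
  shows "(\<integral>s. (g s)\<^sup>2 \<partial>restrict_space lborel {0..t}) \<le> t * e\<^sup>2"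
proof -
  have "(\<integral>s. (g s)\<^sup>2 \<partial>restrict_space lborel {0..t}) = (\<integral>s. indicator {0..t} s * (g s)\<^sup>2 \<partial>lborel)"
    by (subst integral_restrict_space) auto
  also have "\<dots> \<le> (\<integral>s. e\<^sup>2 * indicator {0..t} s \<partial>lborel)"
  proof (rule integral_mono_AE)
    show "integrable lborel (\<lambda>s. indicator {0..t} s * (g s)\<^sup>2)"
      using g by (simp add: square_integrable_def integrable_restrict_space)
    have "integrable lborel (indicator {0..t} :: real \<Rightarrow> real)"
      by (rule integrable_real_indicator) (auto simp: emeasure_lborel_Icc_eq)
    then show "integrable lborel (\<lambda>s. e\<^sup>2 * indicator {0..t} s)"
      by simp
    show "AE s in lborel. indicator {0..t} s * (g s)\<^sup>2 \<le> e\<^sup>2 * indicator {0..t} s"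
      using AE_lborel_singleton[of 0]
    proof eventually_elim
      case (elim s)
      have "(g s)\<^sup>2 \<le> e\<^sup>2" if "s \<in> {0..t}"
        using le[of s] that elim by (intro power2_le_iff_abs_le[THEN iffD2]) auto
      then show ?case by (auto simp: indicator_def)
    qed
  qed
  also have "\<dots> = t * e\<^sup>2" using \<open>0 \<le> t\<close> by simp
  finally show ?thesis .
qed

text \<open>
  Uniform errors \<open>2\<^sup>-\<^sup>k\<close> make the step functions, and by the isometry their integrals, Cauchy at
  a geometric rate in \<open>L\<^sup>2\<close>.
\<close>

lemma (in brownian_motion) ex_has_wiener_integral:
  assumes f: "continuous_on {0..t} f" "square_integrable (restrict_space lborel {0..t}) f" and t: "0 < t"
  shows "\<exists>X. has_wiener_integral M B t f X"
proof -
  let ?L = "restrict_space lborel {0..t}"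
  have "\<exists>\<phi>. step_on t \<phi> \<and> (\<forall>s\<in>{0<..t}. \<bar>step_fun \<phi> s - f s\<bar> \<le> (1 / 2) ^ k)" for k
    by (rule ex_uniform_step_approximation[OF f(1) t]) simp
  then obtain \<phi> where \<phi>: "\<And>k. step_on t (\<phi> k)"
    and le: "\<And>k s. s \<in> {0<..t} \<Longrightarrow> \<bar>step_fun (\<phi> k) s - f s\<bar> \<le> (1 / 2) ^ k"
    by metis
  have pow: "((1 / 2) ^ k)\<^sup>2 = ((1 / 4) ^ k :: real)" for k
    by (simp add: power2_eq_square flip: power_mult_distrib)
  have bound: "expectation (\<lambda>\<omega>. (step_integral B (\<phi> j) \<omega> - step_integral B (\<phi> m) \<omega>)\<^sup>2) \<le> (4 * t) * (1 / 4) ^ j"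
    if "j \<le> m" for j m
  proof -
    have "\<bar>step_fun (\<phi> j) s - step_fun (\<phi> m) s\<bar> \<le> 2 * (1 / 2) ^ j" if "s \<in> {0<..t}" for s
    proof -
      have "(1 / 2) ^ m \<le> ((1 / 2) ^ j :: real)"
        using \<open>j \<le> m\<close> by (intro power_decreasing) auto
      then show ?thesis using le[OF that, of j] le[OF that, of m] by linarith
    qed
    then have "(\<integral>s. (step_fun (\<phi> j) s - step_fun (\<phi> m) s)\<^sup>2 \<partial>?L) \<le> t * (2 * (1 / 2) ^ j)\<^sup>2"
      using t by (intro integral_square_le_of_bound square_integrable_diff square_integrable_step_fun) auto
    then show ?thesis
      by (simp add: step_integral_isometry_diff[OF \<phi> \<phi>] power_mult_distrib pow)
  qed
  obtain X where X: "square_integrable M X"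
    and lim: "(\<lambda>k. expectation (\<lambda>\<omega>. (step_integral B (\<phi> k) \<omega> - X \<omega>)\<^sup>2)) \<longlonglongrightarrow> 0"
    using geometric_L2_Cauchy_imp_convergent[OF square_integrable_step_integral[OF \<phi>] bound] by blast
  have le': "(\<integral>s. (step_fun (\<phi> k) s - f s)\<^sup>2 \<partial>?L) \<le> t * (1 / 4) ^ k" for k
    using integral_square_le_of_bound[OF square_integrable_diff[OF square_integrable_step_fun f(2)] _ le] t
    by (simp add: pow)
  have "(\<lambda>k. t * (1 / 4) ^ k) \<longlonglongrightarrow> t * 0"
    by (intro tendsto_intros LIMSEQ_power_zero) simp
  then have "(\<lambda>k. t * (1 / 4) ^ k) \<longlonglongrightarrow> 0"
    by simp
  then have "(\<lambda>k. \<integral>s. (step_fun (\<phi> k) s - f s)\<^sup>2 \<partial>?L) \<longlonglongrightarrow> 0"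
    by (rule LIMSEQ_zero_of_le[OF _ le', rotated]) simp
  then have "(\<lambda>k. \<integral>\<^sup>+s. ennreal ((step_fun (\<phi> k) s - f s)\<^sup>2) \<partial>?L) \<longlonglongrightarrow> 0"
    by (subst tendsto_nn_integral_square_iff[OF square_integrable_step_fun f(2)])
  moreover have "(\<lambda>k. \<integral>\<^sup>+\<omega>. ennreal ((step_integral B (\<phi> k) \<omega> - X \<omega>)\<^sup>2) \<partial>M) \<longlonglongrightarrow> 0"
    using lim by (subst tendsto_nn_integral_square_iff[OF square_integrable_step_integral[OF \<phi>] X])
  ultimately show ?thesis
    unfolding has_wiener_integral_def using X f(2) \<phi> by blast
qed

text \<open>
  A subsequence of the step integrals converges almost surely. This turns the Wiener integral, an
  object defined up to null sets, into an explicit functional of the path.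
\<close>

lemma (in brownian_motion) wiener_integral_AE_approximation:
  assumes "has_wiener_integral M B t f X"
  obtains \<phi> where "\<And>k. step_on t (\<phi> k)"
    "(\<lambda>k. \<integral>s. (step_fun (\<phi> k) s - f s)\<^sup>2 \<partial>restrict_space lborel {0..t}) \<longlonglongrightarrow> 0"
    "(\<lambda>k. expectation (\<lambda>\<omega>. (step_integral B (\<phi> k) \<omega> - X \<omega>)\<^sup>2)) \<longlonglongrightarrow> 0"
    "AE \<omega> in M. (\<lambda>k. step_integral B (\<phi> k) \<omega>) \<longlonglongrightarrow> X \<omega>"
proof -
  let ?L = "restrict_space lborel {0..t}"
  have f: "square_integrable ?L f" and X: "square_integrable M X"
    using assms by (auto simp: has_wiener_integral_def)
  obtain \<psi> where \<psi>: "\<And>k. step_on t (\<psi> k)"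
    and "(\<lambda>k. \<integral>\<^sup>+s. ennreal ((step_fun (\<psi> k) s - f s)\<^sup>2) \<partial>?L) \<longlonglongrightarrow> 0"
    and "(\<lambda>k. \<integral>\<^sup>+\<omega>. ennreal ((step_integral B (\<psi> k) \<omega> - X \<omega>)\<^sup>2) \<partial>M) \<longlonglongrightarrow> 0"
    using assms unfolding has_wiener_integral_def by blast
  then have lims: "(\<lambda>k. \<integral>s. (step_fun (\<psi> k) s - f s)\<^sup>2 \<partial>?L) \<longlonglongrightarrow> 0"
    "(\<lambda>k. expectation (\<lambda>\<omega>. (step_integral B (\<psi> k) \<omega> - X \<omega>)\<^sup>2)) \<longlonglongrightarrow> 0"
    unfolding tendsto_nn_integral_square_iff[OF square_integrable_step_fun f]
      tendsto_nn_integral_square_iff[OF square_integrable_step_integral[OF \<psi>] X] by auto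
  have "\<exists>r. strict_mono r \<and> (AE \<omega> in M. (\<lambda>k. (step_integral B (\<psi> (r k)) \<omega> - X \<omega>)\<^sup>2) \<longlonglongrightarrow> 0)"
  proof (rule tendsto_L1_AE_subseq)
    show "integrable M (\<lambda>\<omega>. (step_integral B (\<psi> k) \<omega> - X \<omega>)\<^sup>2)" for k
      using square_integrable_diff[OF square_integrable_step_integral[OF \<psi>] X]
      by (simp add: square_integrable_def)
    show "(\<lambda>k. expectation (\<lambda>\<omega>. norm ((step_integral B (\<psi> k) \<omega> - X \<omega>)\<^sup>2))) \<longlonglongrightarrow> 0"
      using lims(2) by simp
  qed
  then obtain r where r: "strict_mono r"
    and AE: "AE \<omega> in M. (\<lambda>k. (step_integral B (\<psi> (r k)) \<omega> - X \<omega>)\<^sup>2) \<longlonglongrightarrow> 0"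
    by blast
  show thesis
  proof (rule that[of "\<lambda>k. \<psi> (r k)"])
    show "AE \<omega> in M. (\<lambda>k. step_integral B (\<psi> (r k)) \<omega>) \<longlonglongrightarrow> X \<omega>"
      using AE by eventually_elim (simp add: LIM_zero_iff)
  qed (use \<psi> LIMSEQ_subseq_LIMSEQ[OF lims(1) r] LIMSEQ_subseq_LIMSEQ[OF lims(2) r]
        in \<open>auto simp: comp_def\<close>)
qed

section \<open>Exponential moments of the Wiener integral\<close>

text \<open>
  A symmetric form of the mean value inequality, from \<open>1 + x \<le> e\<^sup>x\<close>.
\<close>

lemma abs_exp_diff_le:
  fixes x y :: real
  shows "\<bar>exp x - exp y\<bar> \<le> \<bar>x - y\<bar> * (exp x + exp y)"
proof -
  have *: "exp x - exp y \<le> (x - y) * exp x" for x y :: real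
  proof -
    have "exp x * (1 + (y - x)) \<le> exp x * exp (y - x)"
      by (intro mult_left_mono exp_ge_add_one_self) simp
    then show ?thesis by (simp add: algebra_simps flip: exp_add)
  qed
  have **: "\<bar>exp x - exp y\<bar> \<le> \<bar>x - y\<bar> * (exp x + exp y)" if "y \<le> x" for x y :: real
  proof -
    have "\<bar>exp x - exp y\<bar> = exp x - exp y" using that by simp
    also have "\<dots> \<le> (x - y) * exp x" by (rule *)
    also have "\<dots> \<le> \<bar>x - y\<bar> * (exp x + exp y)"
      using that by (intro mult_mono) auto
    finally show ?thesis .
  qed
  show ?thesis
    using **[of y x] **[of x y] by (cases "y \<le> x") (auto simp: abs_minus_commute add.commute)
qed

lemma (in brownian_motion) exp_wiener_integral:
  assumes W: "has_wiener_integral M B t f X"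
  shows integrable_exp_wiener_integral: "integrable M (\<lambda>\<omega>. exp (a * X \<omega>))"
    and expectation_exp_wiener_integral: "expectation (\<lambda>\<omega>. exp (a * X \<omega>)) =
      exp (a\<^sup>2 / 2 * (\<integral>s. (f s)\<^sup>2 \<partial>restrict_space lborel {0..t}))"
proof -
  let ?L = "restrict_space lborel {0..t}"
  have f: "square_integrable ?L f" and X: "square_integrable M X"
    using W by (auto simp: has_wiener_integral_def)
  then have [measurable]: "X \<in> borel_measurable M" by (simp add: square_integrable_def)
  obtain \<phi> where \<phi>: "\<And>k. step_on t (\<phi> k)"
    and lim_f: "(\<lambda>k. \<integral>s. (step_fun (\<phi> k) s - f s)\<^sup>2 \<partial>?L) \<longlonglongrightarrow> 0"
    and lim_X: "(\<lambda>k. expectation (\<lambda>\<omega>. (step_integral B (\<phi> k) \<omega> - X \<omega>)\<^sup>2)) \<longlonglongrightarrow> 0"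
    and AE: "AE \<omega> in M. (\<lambda>k. step_integral B (\<phi> k) \<omega>) \<longlonglongrightarrow> X \<omega>"
    using wiener_integral_AE_approximation[OF W] by blast
  define I where "I k = step_integral B (\<phi> k)" for k
  define v where "v k = (\<integral>s. (step_fun (\<phi> k) s)\<^sup>2 \<partial>?L)" for k
  have I: "square_integrable M (I k)" for k
    unfolding I_def by (rule square_integrable_step_integral[OF \<phi>])
  note exp_I = integrable_exp_step_integral[OF \<phi>, folded I_def]
    expectation_exp_step_integral[OF \<phi>, folded I_def v_def]
  have v: "v \<longlonglongrightarrow> (\<integral>s. (f s)\<^sup>2 \<partial>?L)"
    unfolding v_def by (rule tendsto_integral_square_L2[OF square_integrable_step_fun f lim_f])
  then obtain K where K: "v k \<le> K" for k
    using convergent_imp_Bseq[of v] by (fastforce simp: convergent_def Bseq_def abs_le_iff)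
  have exp_I_le: "expectation (\<lambda>\<omega>. exp (b * I k \<omega>)) \<le> exp (b\<^sup>2 / 2 * K)" for b k
    unfolding exp_I using K[of k] by (simp add: mult_left_mono)
  have exp_X: "integrable M (\<lambda>\<omega>. exp (b * X \<omega>))" "expectation (\<lambda>\<omega>. exp (b * X \<omega>)) \<le> exp (b\<^sup>2 / 2 * K)" for b
  proof -
    have lim: "AE \<omega> in M. (\<lambda>k. exp (b * I k \<omega>)) \<longlonglongrightarrow> exp (b * X \<omega>)"
      using AE unfolding I_def by eventually_elim (intro tendsto_intros)
    have meas: "(\<lambda>\<omega>. exp (b * X \<omega>)) \<in> borel_measurable M" by measurable
    show "integrable M (\<lambda>\<omega>. exp (b * X \<omega>))" "expectation (\<lambda>\<omega>. exp (b * X \<omega>)) \<le> exp (b\<^sup>2 / 2 * K)"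
      by (rule integral_le_of_AE_tendsto[OF exp_I(1) _ meas _ lim always_eventually[OF allI, OF exp_I_le]]; simp)+
  qed
  show "integrable M (\<lambda>\<omega>. exp (a * X \<omega>))" by (rule exp_X)
  have sq: "(exp (a * x))\<^sup>2 = exp (2 * a * x)" for x :: real
    by (simp add: power2_eq_square flip: exp_add)
  have sqX: "square_integrable M (\<lambda>\<omega>. exp (a * X \<omega>))"
    using exp_X(1)[of "2 * a"] by (simp add: square_integrable_def sq)
  have sqI: "square_integrable M (\<lambda>\<omega>. exp (a * I k \<omega>))" for k
    using exp_I(1)[of "2 * a" k] borel_measurable_integrable[OF exp_I(1)[of a k]]
    by (simp add: square_integrable_def sq)
  \<comment> \<open>\<open>?W k\<close> is bounded in \<open>L\<^sup>2\<close> uniformly in \<open>k\<close>, because the exponential moments of order \<open>2 * a\<close>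
    are bounded along the sequence and, by Fatou's lemma, for \<open>X\<close>.\<close>
  let ?W = "\<lambda>k \<omega>. exp (a * I k \<omega>) + exp (a * X \<omega>)"
  have W: "square_integrable M (?W k)" for k
    by (rule square_integrable_add[OF sqI sqX])
  have W_le: "expectation (\<lambda>\<omega>. (?W k \<omega>)\<^sup>2) \<le> 4 * exp ((2 * a)\<^sup>2 / 2 * K)" for k
  proof -
    have "expectation (\<lambda>\<omega>. (?W k \<omega>)\<^sup>2) \<le> expectation (\<lambda>\<omega>. 2 * exp (2 * a * I k \<omega>) + 2 * exp (2 * a * X \<omega>))"
    proof (rule integral_mono)
      show "(?W k \<omega>)\<^sup>2 \<le> 2 * exp (2 * a * I k \<omega>) + 2 * exp (2 * a * X \<omega>)" for \<omega>
        using zero_le_power2[of "exp (a * I k \<omega>) - exp (a * X \<omega>)"]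
        by (simp add: power2_diff power2_sum sq)
    qed (use W exp_I(1)[of "2 * a"] exp_X(1)[of "2 * a"] in \<open>auto simp: square_integrable_def\<close>)
    also have "\<dots> = 2 * expectation (\<lambda>\<omega>. exp (2 * a * I k \<omega>)) + 2 * expectation (\<lambda>\<omega>. exp (2 * a * X \<omega>))"
      using exp_I(1)[of "2 * a"] exp_X(1)[of "2 * a"] by simp
    also have "\<dots> \<le> 4 * exp ((2 * a)\<^sup>2 / 2 * K)"
      using exp_I_le[of "2 * a" k] exp_X(2)[of "2 * a"] by linarith
    finally show ?thesis .
  qed
  have lim_aX: "(\<lambda>k. expectation (\<lambda>\<omega>. (a * I k \<omega> - a * X \<omega>)\<^sup>2)) \<longlonglongrightarrow> 0"
  proof -
    have "expectation (\<lambda>\<omega>. (a * I k \<omega> - a * X \<omega>)\<^sup>2) = a\<^sup>2 * expectation (\<lambda>\<omega>. (I k \<omega> - X \<omega>)\<^sup>2)" for k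
      by (simp add: power_mult_distrib flip: right_diff_distrib)
    then show ?thesis
      using tendsto_mult_right_zero[OF lim_X, of "a\<^sup>2"] by (simp add: I_def)
  qed
  have "(\<lambda>k. expectation (\<lambda>\<omega>. \<bar>a * I k \<omega> - a * X \<omega>\<bar> * ?W k \<omega>)) \<longlonglongrightarrow> 0"
    by (rule tendsto_integral_mult_L2[OF _ _ lim_aX W W_le]; intro square_integrable_cmult I X)
  moreover have "\<bar>expectation (\<lambda>\<omega>. exp (a * I k \<omega>)) - expectation (\<lambda>\<omega>. exp (a * X \<omega>))\<bar>
      \<le> expectation (\<lambda>\<omega>. \<bar>a * I k \<omega> - a * X \<omega>\<bar> * ?W k \<omega>)" for k
  proof -
    have "\<bar>expectation (\<lambda>\<omega>. exp (a * I k \<omega>)) - expectation (\<lambda>\<omega>. exp (a * X \<omega>))\<bar> =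
        \<bar>expectation (\<lambda>\<omega>. exp (a * I k \<omega>) - exp (a * X \<omega>))\<bar>"
      using exp_I(1)[of a k] exp_X(1)[of a] by simp
    also have "\<dots> \<le> expectation (\<lambda>\<omega>. \<bar>exp (a * I k \<omega>) - exp (a * X \<omega>)\<bar>)"
      by (rule integral_abs_bound)
    also have "\<dots> \<le> expectation (\<lambda>\<omega>. \<bar>a * I k \<omega> - a * X \<omega>\<bar> * ?W k \<omega>)"
    proof (rule integral_mono)
      show "integrable M (\<lambda>\<omega>. \<bar>a * I k \<omega> - a * X \<omega>\<bar> * ?W k \<omega>)"
        by (intro square_integrable_mult square_integrable_abs square_integrable_diff
            square_integrable_cmult I X W)
    qed (use exp_I(1)[of a k] exp_X(1)[of a] in \<open>auto intro: abs_exp_diff_le\<close>)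
    finally show ?thesis .
  qed
  ultimately have "(\<lambda>k. \<bar>expectation (\<lambda>\<omega>. exp (a * I k \<omega>)) - expectation (\<lambda>\<omega>. exp (a * X \<omega>))\<bar>) \<longlonglongrightarrow> 0"
    by (rule LIMSEQ_zero_of_le[OF abs_ge_zero, rotated])
  then have "(\<lambda>k. expectation (\<lambda>\<omega>. exp (a * I k \<omega>))) \<longlonglongrightarrow> expectation (\<lambda>\<omega>. exp (a * X \<omega>))"
    by (simp add: tendsto_rabs_zero_iff LIM_zero_iff)
  moreover have "(\<lambda>k. expectation (\<lambda>\<omega>. exp (a * I k \<omega>))) \<longlonglongrightarrow> exp (a\<^sup>2 / 2 * (\<integral>s. (f s)\<^sup>2 \<partial>?L))"
    unfolding exp_I by (intro tendsto_intros v)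
  ultimately show "expectation (\<lambda>\<omega>. exp (a * X \<omega>)) = exp (a\<^sup>2 / 2 * (\<integral>s. (f s)\<^sup>2 \<partial>?L))"
    by (rule LIMSEQ_unique)
qed

section \<open>Malliavin derivative of the exponential of a Wiener integral\<close>

lemma square_integrable_cameron_martin:
  assumes "cameron_martin h h'"
  shows "square_integrable (restrict_space lborel {0..t}) h'"
proof -
  have h': "h' \<in> borel_measurable (restrict_space lborel {0..})"
    "integrable (restrict_space lborel {0..}) (\<lambda>x. (h' x)\<^sup>2)"
    using assms by (auto simp: cameron_martin_def square_integrable_def)
  have "h' \<in> borel_measurable (restrict_space lborel {0..t})"
    by (rule measurable_restrict_mono[OF h'(1)]) auto
  moreover have "set_integrable lborel {0..} (\<lambda>x. (h' x)\<^sup>2)"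
    using h'(2) by (simp add: integrable_restrict_space set_integrable_def)
  then have "set_integrable lborel {0..t} (\<lambda>x. (h' x)\<^sup>2)"
    by (rule set_integrable_subset) auto
  ultimately show ?thesis
    by (simp add: square_integrable_def integrable_restrict_space set_integrable_def)
qed

text \<open>
  Absolute continuity gives the increment as a Henstock--Kurzweil integral of \<open>h'\<close>. As \<open>h'\<close> is square
  integrable on a bounded interval, the Lebesgue integral exists as well and has the same value.
\<close>

lemma cameron_martin_increment:
  assumes h: "cameron_martin h h'" and "0 \<le> a" "a \<le> b" "b \<le> t"
  shows "h b - h a = (\<integral>s. indicator {a<..b} s * h' s \<partial>restrict_space lborel {0..t})"
proof (cases "a = b")
  case False
  with assms have "0 < t" by simp
  define P where "P s \<longleftrightarrow> (0 < s \<longrightarrow> (h has_real_derivative h' s) (at s))" for s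
  have "AE s in lborel. P s"
    using h by (simp add: cameron_martin_def P_def)
  then obtain N where N: "N \<in> null_sets lborel" "{s. \<not> P s} \<subseteq> N"
    by (auto simp: eventually_ae_filter)
  have "negligible (insert 0 N)"
    using null_sets_completionI[OF N(1)] by (simp add: negligible_iff_null_sets[symmetric])
  moreover have "abs_continuous_on {a..b} h"
    using h \<open>0 < t\<close> assms by (auto simp: cameron_martin_def intro: abs_continuous_on_subset)
  moreover have "(h has_vector_derivative h' x) (at x within {a..b})" if "x \<in> {a..b} - insert 0 N" for x
  proof -
    have "P x" "0 < x" using that N(2) \<open>0 \<le> a\<close> by auto
    then have "(h has_real_derivative h' x) (at x within {a..b})"
      by (auto simp: P_def intro: has_field_derivative_at_within)
    then show ?thesis by (simp add: has_real_derivative_iff_has_vector_derivative)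
  qed
  ultimately have "(h' has_integral (h b - h a)) {a..b}"
    using \<open>a \<le> b\<close> by (intro has_integral_derivative_abs_continuous_on)
  moreover have "negligible {x \<in> {a..b} - {a<..b}. h' x \<noteq> 0}" "negligible {x \<in> {a<..b} - {a..b}. h' x \<noteq> 0}"
    by (rule negligible_subset[of "{a}"]; auto)+
  ultimately have hk: "(h' has_integral (h b - h a)) {a<..b}"
    using has_integral_spike_set_eq by blast
  have "integrable (restrict_space lborel {0..t}) (\<lambda>s. indicator {a<..b} s * h' s)"
    by (intro square_integrable_mult square_integrable_indicator square_integrable_cameron_martin[OF h])
  then have "integrable lborel (\<lambda>s. indicator {0..t} s *\<^sub>R (indicator {a<..b} s * h' s))"
    by (simp add: integrable_restrict_space)
  moreover have eq: "indicator {0..t} s *\<^sub>R (indicator {a<..b} s * h' s) = indicator {a<..b} s *\<^sub>R h' s" for s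
    using assms by (auto simp: indicator_def)
  ultimately have int: "set_integrable lborel {a<..b} h'"
    unfolding set_integrable_def eq by simp
  have "h b - h a = integral {a<..b} h'"
    using hk by (simp add: integral_unique)
  also have "\<dots> = (LINT s:{a<..b}|lborel. h' s)"
    using set_borel_integral_eq_integral(2)[OF int] by simp
  also have "\<dots> = (\<integral>s. indicator {0..t} s *\<^sub>R (indicator {a<..b} s * h' s) \<partial>lborel)"
    unfolding set_lebesgue_integral_def eq ..
  also have "\<dots> = (\<integral>s. indicator {a<..b} s * h' s \<partial>restrict_space lborel {0..t})"
    by (rule integral_restrict_space[symmetric]) simp
  finally show ?thesis .
qed simp

text \<open>
  A Cameron--Martin direction \<open>h\<close> can be integrated pathwise: against \<open>h\<close> the step integral is an ordinary
  Lebesgue integral, continuous in the step function with respect to the \<open>L\<^sup>2\<close> norm.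
\<close>

lemma step_integral_cameron_martin:
  assumes h: "cameron_martin h h'" and "step_on t \<phi>"
  shows "step_integral (\<lambda>u _. h u) \<phi> \<omega> = (\<integral>s. step_fun \<phi> s * h' s \<partial>restrict_space lborel {0..t})"
proof -
  obtain n \<tau> c where \<phi>: "\<phi> = (n, \<tau>, c)" by (cases \<phi>)
  note b = step_on_bounds[OF assms(2)[unfolded \<phi>]] step_on_mono[OF assms(2)[unfolded \<phi>]]
  have "step_integral (\<lambda>u _. h u) \<phi> \<omega> = (\<Sum>i<n. c i * (\<integral>s. indicator {\<tau> i<..\<tau> (Suc i)} s * h' s \<partial>restrict_space lborel {0..t}))"
    unfolding \<phi> step_integral_def prod.case
    using b by (intro sum.cong refl arg_cong2[where f="(*)"] cameron_martin_increment[OF h]) auto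
  also have "\<dots> = (\<integral>s. (\<Sum>i<n. c i * (indicator {\<tau> i<..\<tau> (Suc i)} s * h' s)) \<partial>restrict_space lborel {0..t})"
    by (subst Bochner_Integration.integral_sum)
      (auto intro!: square_integrable_mult square_integrable_indicator square_integrable_cameron_martin[OF h])
  also have "\<dots> = (\<integral>s. step_fun \<phi> s * h' s \<partial>restrict_space lborel {0..t})"
    by (simp only: \<phi> step_fun_def prod.case sum_distrib_right mult.assoc)
  finally show ?thesis .
qed

lemma step_integral_path:
  assumes "step_on t \<phi>"
  shows "step_integral (\<lambda>u x. x u) \<phi> (path B t \<omega>) = step_integral B \<phi> \<omega>"
proof -
  obtain n \<tau> c where \<phi>: "\<phi> = (n, \<tau>, c)" by (cases \<phi>)
  note b = step_on_bounds[OF assms(1)[unfolded \<phi>]]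
  show ?thesis
    unfolding \<phi> step_integral_def prod.case path_def
    using b by (intro sum.cong) auto
qed

lemma step_integral_shift:
  "step_integral (\<lambda>u \<omega>. B u \<omega> + \<epsilon> * h u) \<phi> \<omega> =
    step_integral B \<phi> \<omega> + \<epsilon> * step_integral (\<lambda>u _. h u) \<phi> \<omega>"
  by (cases \<phi>) (simp add: step_integral_def sum_distrib_left algebra_simps flip: sum.distrib)

lemma borel_measurable_step_integral_path:
  assumes "step_on t \<phi>"
  shows "step_integral (\<lambda>u x. x u) \<phi> \<in> borel_measurable (PiM {0..t} (\<lambda>_. borel))"
proof -
  obtain n \<tau> c where \<phi>: "\<phi> = (n, \<tau>, c)" by (cases \<phi>)
  note b = step_on_bounds[OF assms(1)[unfolded \<phi>]]
  show ?thesis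
    unfolding \<phi> step_integral_def prod.case
    using b by (intro borel_measurable_sum borel_measurable_times borel_measurable_diff
        borel_measurable_const measurable_component_singleton) auto
qed

text \<open>
  The representative \<open>\<Phi>\<close> is the exponential of the limit of the step integrals, taken along an almost
  surely convergent sequence. The exceptional null set, where the limit along \<open>B\<close> is not
  \<open>X\<close> or \<open>V\<close> is not \<open>c exp(a X)\<close>, depends neither on \<open>h\<close> nor on \<open>\<epsilon>\<close>.
\<close>

lemma (in brownian_motion) has_malliavin_derivative_exp_wiener_integral:
  assumes complete: "complete_measure M"
    and W: "has_wiener_integral M B t f X"
    and V: "AE \<omega> in M. V \<omega> = c * exp (a * X \<omega>)"
  shows "has_malliavin_derivative M B t V (\<lambda>s \<omega>. a * V \<omega> * f s)"
proof -
  let ?L = "restrict_space lborel {0..t}"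
  have f: "square_integrable ?L f" and X: "square_integrable M X"
    using W by (auto simp: has_wiener_integral_def)
  then have [measurable]: "X \<in> borel_measurable M" by (simp add: square_integrable_def)
  obtain \<phi> where \<phi>: "\<And>k. step_on t (\<phi> k)"
    and lim_f: "(\<lambda>k. \<integral>s. (step_fun (\<phi> k) s - f s)\<^sup>2 \<partial>?L) \<longlonglongrightarrow> 0"
    and AE: "AE \<omega> in M. (\<lambda>k. step_integral B (\<phi> k) \<omega>) \<longlonglongrightarrow> X \<omega>"
    using wiener_integral_AE_approximation[OF W] by blast
  have "(\<lambda>\<omega>. c * exp (a * X \<omega>)) \<in> borel_measurable M" by measurable
  moreover have V': "AE \<omega> in M. c * exp (a * X \<omega>) = V \<omega>" using V by eventually_elim simp
  ultimately have V_meas: "V \<in> borel_measurable M"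
    by (rule complete_measure.borel_measurable_AE_eq[OF complete])
  have sqX: "square_integrable M (\<lambda>\<omega>. exp (a * X \<omega>))"
    using integrable_exp_wiener_integral[OF W, of "2 * a"]
    by (simp add: square_integrable_def power2_eq_square mult.assoc flip: exp_add)
  have sqV: "square_integrable M V"
    by (rule square_integrable_cong_AE[OF square_integrable_cmult[OF sqX, of c] V_meas V'])
  have sqD: "square_integrable (?L \<Otimes>\<^sub>M M) (\<lambda>(s, \<omega>). a * V \<omega> * f s)"
  proof -
    have "sigma_finite_measure ?L"
      by (rule sigma_finite_measure_restrict_space) (auto intro: sigma_finite_lborel)
    moreover have "sigma_finite_measure M" ..
    ultimately show ?thesis
      using square_integrable_pair_mult[OF _ _ f square_integrable_cmult[OF sqV, of a]]
      by (simp add: mult.commute)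
  qed
  define \<Phi> where "\<Phi> x = c * exp (a * lim (\<lambda>k. step_integral (\<lambda>u x. x u) (\<phi> k) x))" for x :: "real \<Rightarrow> real"
  have \<Phi>_meas: "\<Phi> \<in> borel_measurable (PiM {0..t} (\<lambda>_. borel))"
  proof -
    have [measurable]: "step_integral (\<lambda>u x. x u) (\<phi> k) \<in> borel_measurable (PiM {0..t} (\<lambda>_. borel))" for k
      by (rule borel_measurable_step_integral_path[OF \<phi>])
    show ?thesis unfolding \<Phi>_def by measurable
  qed
  have "AE \<omega> in M. V \<omega> = \<Phi> (path B t \<omega>)"
    using AE V by eventually_elim (simp add: \<Phi>_def step_integral_path[OF \<phi>] limI)
  moreover have "AE \<omega> in M.
      ((\<lambda>\<epsilon>. \<Phi> (path (\<lambda>u \<omega>. B u \<omega> + \<epsilon> * h u) t \<omega>)) has_real_derivative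
        (LINT s:{0..t}|lborel. a * V \<omega> * f s * h' s)) (at 0)"
    if h: "cameron_martin h h'" for h h'
    using AE V
  proof eventually_elim
    case (elim \<omega>)
    define K where "K = (\<integral>s. f s * h' s \<partial>?L)"
    have "(\<lambda>k. step_integral (\<lambda>u _. h u) (\<phi> k) \<omega>) \<longlonglongrightarrow> K"
      unfolding step_integral_cameron_martin[OF h \<phi>] K_def
      by (rule tendsto_integral_mult_const_L2[OF square_integrable_step_fun f lim_f
            square_integrable_cameron_martin[OF h]])
    then have "(\<lambda>k. step_integral B (\<phi> k) \<omega> + \<epsilon> * step_integral (\<lambda>u _. h u) (\<phi> k) \<omega>) \<longlonglongrightarrow> X \<omega> + \<epsilon> * K" for \<epsilon>
      by (intro tendsto_intros elim)
    then have shift: "\<Phi> (path (\<lambda>u \<omega>. B u \<omega> + \<epsilon> * h u) t \<omega>) = c * exp (a * (X \<omega> + \<epsilon> * K))" for \<epsilon>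
      by (simp add: \<Phi>_def step_integral_path[OF \<phi>] step_integral_shift limI)
    have "(LINT s:{0..t}|lborel. a * V \<omega> * f s * h' s) = (\<integral>s. a * V \<omega> * (f s * h' s) \<partial>?L)"
      by (simp add: set_lebesgue_integral_def integral_restrict_space mult.assoc)
    also have "\<dots> = c * exp (a * X \<omega>) * a * K"
      by (simp add: K_def elim)
    finally have D: "(LINT s:{0..t}|lborel. a * V \<omega> * f s * h' s) = c * exp (a * X \<omega>) * a * K" .
    show ?case
      unfolding shift D by (auto intro!: derivative_eq_intros)
  qed
  ultimately show ?thesis
    unfolding has_malliavin_derivative_def using sqV sqD \<Phi>_meas by blast
qed

theorem theorem8p1:
  fixes M :: "'a measure" and B BF v :: "real \<Rightarrow> 'a \<Rightarrow> real"
    and F :: "real \<Rightarrow> real \<Rightarrow> real" and v0 t :: real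
  assumes complete: "complete_measure M"
    and BM: "standard_brownian_motion M B"
    and F_cont: "continuous_on UNIV (\<lambda>(t, r). F t r)"
    and F_L2: "square_integrable (lborel :: (real \<times> real) measure) (\<lambda>(t, r). F t r)"
    and F_cov: "\<And>t s. 0 < t \<Longrightarrow> 0 < s \<Longrightarrow> (LINT r:{0..min t s}|lborel. F t r * F s r) \<noteq> 0"
    and F_sec: "\<And>t. 0 \<le> t \<Longrightarrow> square_integrable lborel (F t)"
    and v0: "0 < v0"
    and BF: "\<And>t. 0 \<le> t \<Longrightarrow> AE \<omega> in M. BF t \<omega> = wiener_integral M B t (F t) \<omega>"
    and v: "\<And>t \<omega>. 0 \<le> t \<Longrightarrow> v t \<omega> = v0 * exp (BF t \<omega>)"
    and t: "0 < t"
  shows "prob_space.expectation M (v t) =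
           v0 * exp (1 / 2 * (LINT s:{0..t}|lborel. (F t s)\<^sup>2)) \<and>
         has_malliavin_derivative M B t (v t) (\<lambda>s \<omega>. v t \<omega> * F t s) \<and>
         has_malliavin_derivative M B t (\<lambda>\<omega>. 1 / v t \<omega>) (\<lambda>s \<omega>. - (1 / v t \<omega>) * F t s)"
proof -
  interpret brownian_motion M B
    using BM by (intro brownian_motion.intro brownian_motion_axioms.intro)
      (auto simp: standard_brownian_motion_def)
  let ?L = "restrict_space lborel {0..t}"
  have "continuous_on {0..t} (\<lambda>r. (\<lambda>(t, r). F t r) (t, r))"
    by (rule continuous_on_compose2[OF F_cont]) (auto intro!: continuous_intros)
  then have cont: "continuous_on {0..t} (F t)" by simp
  have sq: "square_integrable ?L (F t)"
  proof -
    have F: "F t \<in> borel_measurable lborel" "integrable lborel (\<lambda>s. (F t s)\<^sup>2)"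
      using F_sec[of t] t by (auto simp: square_integrable_def)
    have "F t \<in> borel_measurable ?L" by (rule measurable_restrict_space1[OF F(1)])
    moreover have "integrable ?L (\<lambda>s. (F t s)\<^sup>2)"
      using integrable_mult_indicator[OF _ F(2), of "{0..t}"] by (simp add: integrable_restrict_space)
    ultimately show ?thesis by (simp add: square_integrable_def)
  qed
  define X where "X = wiener_integral M B t (F t)"
  have W: "has_wiener_integral M B t (F t) X"
    unfolding X_def wiener_integral_def
    using ex_has_wiener_integral[OF cont sq t] by (rule someI_ex)
  then have [measurable]: "X \<in> borel_measurable M"
    by (simp add: has_wiener_integral_def square_integrable_def)
  have BF_X: "AE \<omega> in M. BF t \<omega> = X \<omega>"
    using BF[of t] t by (simp add: X_def)
  have v_X: "AE \<omega> in M. v t \<omega> = v0 * exp (1 * X \<omega>)"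
    using BF_X by eventually_elim (use v t in simp)
  have inv_v_X: "AE \<omega> in M. 1 / v t \<omega> = 1 / v0 * exp (- 1 * X \<omega>)"
    using BF_X by eventually_elim (use v t in \<open>simp add: exp_minus divide_inverse\<close>)
  have d: "has_malliavin_derivative M B t (v t) (\<lambda>s \<omega>. v t \<omega> * F t s)"
    using has_malliavin_derivative_exp_wiener_integral[OF complete W v_X] by simp
  have "has_malliavin_derivative M B t (\<lambda>\<omega>. 1 / v t \<omega>) (\<lambda>s \<omega>. - 1 * (1 / v t \<omega>) * F t s)"
    by (rule has_malliavin_derivative_exp_wiener_integral[OF complete W inv_v_X])
  then have d': "has_malliavin_derivative M B t (\<lambda>\<omega>. 1 / v t \<omega>) (\<lambda>s \<omega>. - (1 / v t \<omega>) * F t s)"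
    by simp
  have "expectation (v t) = expectation (\<lambda>\<omega>. v0 * exp (1 * X \<omega>))"
    using v_X d by (intro integral_cong_AE)
      (auto simp: has_malliavin_derivative_def square_integrable_def)
  also have "\<dots> = v0 * exp (1 / 2 * (\<integral>s. (F t s)\<^sup>2 \<partial>?L))"
    using expectation_exp_wiener_integral[OF W, of 1] by simp
  also have "(\<integral>s. (F t s)\<^sup>2 \<partial>?L) = (LINT s:{0..t}|lborel. (F t s)\<^sup>2)"
    by (simp add: set_lebesgue_integral_def integral_restrict_space)
  finally show ?thesis using d d' by simp
qed

end
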